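(* For each positive integer $n$, let $0<p_n,q_n\le 1$ and let $\lambda^{(0)}$ be a (possibly random) partition of $n$. Let $(\lambda^{(0)},\lambda^{(1)},\dotsc)$ be the Markov chain on the set $\mathcal{P}(n)$ of integer partitions of $n$ given by $p_n$-random $q_n$-proportion Bulgarian solitaire $\mathscr{B}(n,p_n,q_n)$, and let $\pi_{n,p_n,q_n}$ be its stationary measure. Suppose \[ p_nq_n\to 0\quad\text{and}\quad \frac{p_nq_n^2 n}{\log n}\to\infty\qquad(n\to\infty). \] Then $\pi_{n,p_n,q_n}$ has the limit shape $\phi(x)=e^{-x}$ under the scaling $a_n=(p_nq_n)^{-1}$, i.e. for every $x>0$ and every $\varepsilon>0$, \[ \lim_{n\to\infty}\pi_{n,p_n,q_n}\{\lambda\in\mathcal{P}(n): |\rho_{a_n}(\lambda)(x)-e^{-x}|<\varepsilon\}=1. \]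
   Context: $p$-random $q$-proportion Bulgarian solitaire $\mathscr{B}(n,p,q)$ ($0<p,q\le 1$) is played on $n$ identical cards distributed in piles; a configuration is the partition of $n$ given by the pile sizes. In one move, from each pile of size $h$ the top $\lceil qh\rceil$ cards are candidates; each candidate card is picked with probability $p$, independently of all other candidate cards; all picked cards are removed from their piles and together form one new pile (if no card is picked, no new pile arises). For $p<1$ this Markov chain on $\mathcal{P}(n)$ is irreducible and aperiodic, and $\pi_{n,p,q}$ denotes its unique stationary distribution. For a partition $\lambda=(\lambda_1\ge\lambda_2\ge\dotsb)$ of $n$ (with $\lambda_i=0$ beyond its number of parts) and scaling factor $a>0$, the rescaled diagram-boundary function is $\rho_a(\lambda)(x)=\frac{a}{n}\lambda_{\lfloor ax\rfloor+1}$ for $x\ge 0$. *)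

theory Defs
  imports Complex_Main
begin

definition partitions :: "nat \<Rightarrow> nat list set" where
  "partitions n = {xs. sorted_wrt (\<ge>) xs \<and> 0 \<notin> set xs \<and> sum_list xs = n}"

definition cand :: "real \<Rightarrow> nat \<Rightarrow> nat" where
  "cand q h = nat \<lceil>q * real h\<rceil>"

definition move :: "nat list \<Rightarrow> nat list \<Rightarrow> nat list" where
  "move lam ks = rev (sort (filter (\<lambda>x. x > 0) (map (\<lambda>(h, k). h - k) (zip lam ks))
                   @ (if sum_list ks > 0 then [sum_list ks] else [])))"

definition picks :: "real \<Rightarrow> nat list \<Rightarrow> nat list set" where
  "picks q lam = {ks. length ks = length lam \<and> (\<forall>i<length lam. ks ! i \<le> cand q (lam ! i))}"

text \<open>Probability of picking exactly the vector ks (independent Bernoulli(p) choices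
  of each candidate card, so binomially many from each pile).\<close>
definition pick_prob :: "real \<Rightarrow> real \<Rightarrow> nat list \<Rightarrow> nat list \<Rightarrow> real" where
  "pick_prob p q lam ks = (\<Prod>i<length lam.
      real (cand q (lam ! i) choose ks ! i) * p ^ (ks ! i) * (1 - p) ^ (cand q (lam ! i) - ks ! i))"

definition trans_prob :: "real \<Rightarrow> real \<Rightarrow> nat list \<Rightarrow> nat list \<Rightarrow> real" where
  "trans_prob p q lam mu = (\<Sum>ks\<in>{ks\<in>picks q lam. move lam ks = mu}. pick_prob p q lam ks)"

definition stationary :: "real \<Rightarrow> real \<Rightarrow> nat \<Rightarrow> (nat list \<Rightarrow> real) \<Rightarrow> bool" where
  "stationary p q n \<pi> \<longleftrightarrow>
     (\<forall>lam\<in>partitions n. \<pi> lam \<ge> 0) \<and>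
     (\<Sum>lam\<in>partitions n. \<pi> lam) = 1 \<and>
     (\<forall>mu\<in>partitions n. \<pi> mu = (\<Sum>lam\<in>partitions n. \<pi> lam * trans_prob p q lam mu))"

definition part :: "nat list \<Rightarrow> nat \<Rightarrow> nat" where
  "part lam i = (if 1 \<le> i \<and> i \<le> length lam then lam ! (i - 1) else 0)"

definition rho :: "real \<Rightarrow> nat \<Rightarrow> nat list \<Rightarrow> real \<Rightarrow> real" where
  "rho a n lam x = a / real n * real (part lam (nat \<lfloor>a * x\<rfloor> + 1))"

end

theory Submission
  imports
    Defs
    "HOL-Analysis.Weierstrass_Theorems"
    "HOL-Analysis.Harmonic_Numbers"
    "HOL-Analysis.Henstock_Kurzweil_Integration"
begin

text \<open>
  Write \<open>s = pq\<close>, \<open>N = sn\<close>, give a pile of \<open>h\<close> cards the height \<open>z = h / N\<close>, and let \<open>Z\<close> be the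
  height of the new pile. A function of the form \<open>\<Sum> g z\<close> has the same stationary mean before and
  after a move. For the harmonic numbers as potential this bounds the mean number of piles by
  \<open>(1 + ln n) / s\<close>, so that rounding up the number of candidates is negligible and \<open>Z\<close> is close
  to 1 in mean; for \<open>max 0 (z - 3/2)\<close> it shows that piles of height at least 2 carry little mass.

  For \<open>M\<^sub>k = s \<Sum> z\<^sup>k\<close> a move has drift about \<open>s (1 - k M\<^sub>k)\<close> and increments of order \<open>s\<close>. Stationarity
  of \<open>M\<^sub>k\<close> and of its square therefore gives that \<open>M\<^sub>k\<close> is close to \<open>1 / k\<close> in mean square, and these are
  the moments of the shape \<open>exp (- x)\<close>. By the Weierstrass theorem \<open>s \<Sum> z W z\<close> is then close to
  \<open>\<integral>\<^sub>0\<^sup>1 W\<close> for continuous \<open>W\<close>. Functions \<open>W\<close> approximating \<open>1 / z\<close> on \<open>[y, \<infinity>)\<close> and 0 elsewhere count the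
  piles of height at least \<open>y\<close>, so that about \<open>- ln y / s\<close> piles reach height \<open>y\<close>.
\<close>

section \<open>Expectations over the picked cards\<close>

text \<open>The Bernstein polynomials at \<open>p\<close> are the weights of the binomial law, so
  their moment identities give mean and variance of the number of cards picked from one
  pile.\<close>

definition bin_exp :: "real \<Rightarrow> nat \<Rightarrow> (nat \<Rightarrow> real) \<Rightarrow> real" where
  "bin_exp p c F = (\<Sum>k\<le>c. Bernstein c k p * F k)"

definition pick_exp :: "real \<Rightarrow> real \<Rightarrow> nat list \<Rightarrow> (nat list \<Rightarrow> real) \<Rightarrow> real" where
  "pick_exp p q lam F = (\<Sum>ks\<in>picks q lam. pick_prob p q lam ks * F ks)"

lemma bin_exp_const [simp]: "bin_exp p c (\<lambda>k. a) = a"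
  by (simp add: bin_exp_def sum_distrib_right [symmetric])

lemma bin_exp_add: "bin_exp p c (\<lambda>k. F k + G k) = bin_exp p c F + bin_exp p c G"
  by (simp add: bin_exp_def sum.distrib algebra_simps)

lemma bin_exp_diff: "bin_exp p c (\<lambda>k. F k - G k) = bin_exp p c F - bin_exp p c G"
  by (simp add: bin_exp_def sum_subtractf algebra_simps)

lemma bin_exp_cmult: "bin_exp p c (\<lambda>k. a * F k) = a * bin_exp p c F"
  by (simp add: bin_exp_def sum_distrib_left algebra_simps)

lemma bin_exp_mono:
  assumes "0 \<le> p" "p \<le> 1" "\<And>k. k \<le> c \<Longrightarrow> F k \<le> G k"
  shows "bin_exp p c F \<le> bin_exp p c G"
  unfolding bin_exp_def using assms by (intro sum_mono mult_left_mono) (auto simp: Bernstein_nonneg)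

lemma bin_exp_id: "bin_exp p c real = p * c"
  using sum_k_Bernstein [of c p] by (simp add: bin_exp_def mult.commute)

lemma bin_exp_square: "bin_exp p c (\<lambda>k. (real k)\<^sup>2) = (p * c)\<^sup>2 + p * (1 - p) * c"
proof -
  have "bin_exp p c (\<lambda>k. (real k)\<^sup>2)
      = (\<Sum>k\<le>c. real k * (real k - 1) * Bernstein c k p) + (\<Sum>k\<le>c. real k * Bernstein c k p)"
    unfolding bin_exp_def sum.distrib [symmetric]
    by (intro sum.cong) (auto simp: algebra_simps power2_eq_square)
  also have "\<dots> = real c * (real c - 1) * p\<^sup>2 + real c * p"
    by (simp only: sum_kk_Bernstein sum_k_Bernstein)
  finally show ?thesis
    by (simp add: algebra_simps power2_eq_square)
qed

lemma bin_exp_variance: "bin_exp p c (\<lambda>k. (real k - p * c)\<^sup>2) = p * (1 - p) * c"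
proof -
  have "bin_exp p c (\<lambda>k. (real k - p * c)\<^sup>2)
      = bin_exp p c (\<lambda>k. ((real k)\<^sup>2 - (2 * (p * c)) * real k) + (p * c)\<^sup>2)"
    by (intro arg_cong [where f = "bin_exp p c"] ext) (simp add: power2_eq_square algebra_simps)
  also have "\<dots> = p * (1 - p) * c"
    by (simp only: bin_exp_add bin_exp_diff bin_exp_cmult bin_exp_id bin_exp_square bin_exp_const)
       (simp add: power2_eq_square algebra_simps)
  finally show ?thesis .
qed

section \<open>Independent picks from all piles\<close>

lemma picks_Nil [simp]: "picks q [] = {[]}"
  by (auto simp: picks_def)

lemma picks_Cons:
  "picks q (h # lam) = (\<lambda>(k, ks). k # ks) ` ({..cand q h} \<times> picks q lam)"
proof -
  have "ks \<in> (\<lambda>(k, ks). k # ks) ` ({..cand q h} \<times> picks q lam)"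
    if "ks \<in> picks q (h # lam)" for ks
    using that by (cases ks) (force simp: picks_def)+
  moreover have "k # ks \<in> picks q (h # lam)" if "k \<le> cand q h" "ks \<in> picks q lam" for k ks
    using that by (auto simp: picks_def nth_Cons split: nat.splits)
  ultimately show ?thesis by auto
qed

lemma finite_picks [simp]: "finite (picks q lam)"
  by (induction lam) (auto simp: picks_Cons)

lemma pick_exp_Nil [simp]: "pick_exp p q [] F = F []"
  by (simp add: pick_exp_def pick_prob_def)

text \<open>Independence of the piles: the product in \<open>pick_prob\<close> splits off its first
  factor. Mean and variance of sums over the piles follow by induction.\<close>

lemma pick_exp_Cons:
  "pick_exp p q (h # lam) F
     = bin_exp p (cand q h) (\<lambda>k. pick_exp p q lam (\<lambda>ks. F (k # ks)))"
proof -
  have "inj_on (\<lambda>(k, ks). k # ks) ({..cand q h} \<times> picks q lam)"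
    by (auto simp: inj_on_def)
  then have "pick_exp p q (h # lam) F
      = (\<Sum>(k, ks)\<in>{..cand q h} \<times> picks q lam. pick_prob p q (h # lam) (k # ks) * F (k # ks))"
    by (simp add: pick_exp_def picks_Cons sum.reindex case_prod_unfold)
  also have "\<dots> = (\<Sum>(k, ks)\<in>{..cand q h} \<times> picks q lam.
      Bernstein (cand q h) k p * (pick_prob p q lam ks * F (k # ks)))"
    by (intro sum.cong)
       (auto simp: pick_prob_def Bernstein_def prod.lessThan_Suc_shift simp del: prod.lessThan_Suc)
  finally show ?thesis
    by (simp add: bin_exp_def pick_exp_def sum.cartesian_product sum_distrib_left)
qed

lemma pick_exp_const [simp]: "pick_exp p q lam (\<lambda>ks. a) = a"
  by (induction lam) (simp_all add: pick_exp_Cons)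

lemma pick_exp_add: "pick_exp p q lam (\<lambda>ks. F ks + G ks) = pick_exp p q lam F + pick_exp p q lam G"
  by (simp add: pick_exp_def sum.distrib algebra_simps)

lemma pick_exp_diff: "pick_exp p q lam (\<lambda>ks. F ks - G ks) = pick_exp p q lam F - pick_exp p q lam G"
  by (simp add: pick_exp_def sum_subtractf algebra_simps)

lemma pick_exp_cmult: "pick_exp p q lam (\<lambda>ks. a * F ks) = a * pick_exp p q lam F"
  by (simp add: pick_exp_def sum_distrib_left algebra_simps)

lemma pick_exp_cong:
  assumes "\<And>ks. ks \<in> picks q lam \<Longrightarrow> F ks = G ks"
  shows "pick_exp p q lam F = pick_exp p q lam G"
  unfolding pick_exp_def using assms by (intro sum.cong) auto

lemma pick_prob_nonneg: "0 \<le> p \<Longrightarrow> p \<le> 1 \<Longrightarrow> 0 \<le> pick_prob p q lam ks"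
  unfolding pick_prob_def by (intro prod_nonneg) auto

lemma pick_exp_mono:
  assumes "0 \<le> p" "p \<le> 1" "\<And>ks. ks \<in> picks q lam \<Longrightarrow> F ks \<le> G ks"
  shows "pick_exp p q lam F \<le> pick_exp p q lam G"
  unfolding pick_exp_def using assms by (intro sum_mono mult_left_mono) (auto simp: pick_prob_nonneg)

lemma pick_exp_sum_map2:
  "pick_exp p q lam (\<lambda>ks. sum_list (map2 g lam ks)) = (\<Sum>h\<leftarrow>lam. bin_exp p (cand q h) (g h))"
  by (induction lam) (simp_all add: pick_exp_Cons pick_exp_add bin_exp_add)

definition pick_mean :: "real \<Rightarrow> real \<Rightarrow> nat list \<Rightarrow> real" where
  "pick_mean p q lam = (\<Sum>h\<leftarrow>lam. p * cand q h)"

lemma pick_exp_sum: "pick_exp p q lam (\<lambda>ks. real (sum_list ks)) = pick_mean p q lam"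
  by (induction lam) (simp_all add: pick_mean_def pick_exp_Cons pick_exp_add bin_exp_add bin_exp_id)

text \<open>Variances of independent picks add up, and a pile with mean \<open>p * c\<close>
  contributes \<open>p * (1 - p) * c\<close>, which is \<open>1 - p\<close> times its mean.\<close>

lemma pick_exp_variance:
  "pick_exp p q lam (\<lambda>ks. (real (sum_list ks) - pick_mean p q lam)\<^sup>2)
     = (1 - p) * pick_mean p q lam"
proof (induction lam)
  case Nil
  then show ?case by (simp add: pick_mean_def)
next
  case (Cons h lam)
  let ?m = "pick_mean p q lam" and ?c = "p * real (cand q h)"
  have m: "pick_mean p q (h # lam) = ?c + ?m"
    by (simp add: pick_mean_def)
  have "pick_exp p q lam (\<lambda>ks. (real (sum_list (k # ks)) - (?c + ?m))\<^sup>2)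
      = (real k - ?c)\<^sup>2 + (1 - p) * ?m" for k
  proof -
    \<comment> \<open>When the square is expanded around both means, the mixed term has mean
      zero.\<close>
    have "pick_exp p q lam (\<lambda>ks. (real (sum_list (k # ks)) - (?c + ?m))\<^sup>2)
       = pick_exp p q lam (\<lambda>ks. ((real k - ?c)\<^sup>2 + (2 * (real k - ?c)) * (real (sum_list ks) - ?m))
            + (real (sum_list ks) - ?m)\<^sup>2)"
      by (intro pick_exp_cong) (simp add: power2_eq_square algebra_simps)
    then show ?thesis
      by (simp only: pick_exp_add pick_exp_cmult pick_exp_diff pick_exp_const pick_exp_sum Cons.IH)
         simp
  qed
  then show ?case
    by (simp only: m pick_exp_Cons bin_exp_add bin_exp_variance bin_exp_const)
       (simp add: algebra_simps)
qed

text \<open>The inequality of arithmetic and geometric means bounds \<open>\<bar>x\<bar>\<close> by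
  \<open>(x\<^sup>2 / A + A) / 2\<close>, so the variance suffices. Later \<open>A\<close> is
  \<open>sqrt N\<close>.\<close>

lemma pick_exp_abs_dev_le:
  assumes "0 \<le> p" "p \<le> 1" "A > 0"
  shows "pick_exp p q lam (\<lambda>ks. \<bar>real (sum_list ks) - pick_mean p q lam\<bar>)
     \<le> (pick_mean p q lam / A + A) / 2"
proof -
  let ?X = "\<lambda>ks. real (sum_list ks) - pick_mean p q lam"
  have m: "pick_mean p q lam \<ge> 0"
    unfolding pick_mean_def using assms by (intro sum_list_nonneg) auto
  have amgm: "\<bar>x\<bar> \<le> (1 / (2 * A)) * x\<^sup>2 + A / 2" for x
  proof -
    have "0 \<le> (\<bar>x\<bar> - A)\<^sup>2" by simp
    then have "2 * A * \<bar>x\<bar> \<le> x\<^sup>2 + A\<^sup>2" by (simp add: power2_diff algebra_simps)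
    then show ?thesis using assms by (simp add: field_simps power2_eq_square)
  qed
  have "pick_exp p q lam (\<lambda>ks. \<bar>?X ks\<bar>)
      \<le> pick_exp p q lam (\<lambda>ks. (1 / (2 * A)) * (?X ks)\<^sup>2 + A / 2)"
    using assms amgm by (intro pick_exp_mono) auto
  also have "\<dots> = (1 / (2 * A)) * ((1 - p) * pick_mean p q lam) + A / 2"
    by (simp only: pick_exp_add pick_exp_cmult pick_exp_variance pick_exp_const)
  also have "\<dots> \<le> (1 / (2 * A)) * pick_mean p q lam + A / 2"
    using assms m by (intro add_right_mono mult_left_mono mult_left_le_one_le) auto
  finally show ?thesis by (simp add: field_simps)
qed

section \<open>The effect of a move\<close>

lemma finite_partitions [simp]: "finite (partitions n)"
proof (rule finite_subset)
  show "partitions n \<subseteq> {xs. set xs \<subseteq> {..n} \<and> length xs \<le> n}"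
  proof
    fix xs assume "xs \<in> partitions n"
    then have xs: "0 \<notin> set xs" "sum_list xs = n" by (auto simp: partitions_def)
    have "set xs \<subseteq> {..n}" using xs member_le_sum_list by fastforce
    moreover have "length xs \<le> sum_list xs" using xs(1)
      by (induction xs) (auto simp: Suc_le_eq)
    ultimately show "xs \<in> {xs. set xs \<subseteq> {..n} \<and> length xs \<le> n}" using xs by simp
  qed
qed (rule finite_lists_length_le, simp)

lemma cand_le:
  assumes "q \<le> 1"
  shows "cand q h \<le> h"
proof -
  have "q * real h \<le> real h" using assms by (simp add: mult_left_le_one_le mult_le_cancel_right2)
  then show ?thesis unfolding cand_def by (simp add: nat_le_iff ceiling_le_iff)
qed

text \<open>The extra card comes from rounding up; summed over the piles it produces the error
  \<open>excess\<close>.\<close>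

lemma cand_bounds:
  assumes "0 \<le> q"
  shows "q * real h \<le> real (cand q h)" "real (cand q h) \<le> q * real h + 1"
  using assms by (auto simp: cand_def of_nat_nat real_nat_ceiling_ge)

lemma sum_list_map2_diff:
  assumes "ks \<in> picks q lam" "q \<le> 1"
  shows "sum_list (map2 (-) lam ks) + sum_list ks = sum_list lam"
  using assms
proof (induction lam arbitrary: ks)
  case (Cons h lam)
  then obtain k ks' where "ks = k # ks'" "k \<le> cand q h" "ks' \<in> picks q lam"
    by (auto simp: picks_Cons)
  moreover have "cand q h \<le> h" using Cons.prems cand_le by auto
  ultimately show ?case using Cons.IH [of ks'] Cons.prems by auto
qed auto

lemma sum_list_filter_pos: "sum_list (filter (\<lambda>x. x > 0) xs) = sum_list (xs :: nat list)"
  by (induction xs) auto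

lemma move_in_partitions:
  assumes "lam \<in> partitions n" "ks \<in> picks q lam" "q \<le> 1"
  shows "move lam ks \<in> partitions n"
proof -
  have "sum_list (move lam ks) = sum_list (map2 (-) lam ks) + sum_list ks"
  proof -
    have "sum_list (rev (sort xs)) = sum_list xs" for xs :: "nat list"
      by (metis mset_rev mset_sort sum_mset_sum_list)
    then show ?thesis by (simp add: move_def sum_list_filter_pos)
  qed
  moreover have "sorted_wrt (\<ge>) (move lam ks)"
    unfolding move_def by (simp add: sorted_wrt_rev)
  moreover have "0 \<notin> set (move lam ks)" by (auto simp: move_def)
  ultimately show ?thesis
    using assms sum_list_map2_diff by (simp add: partitions_def)
qed

text \<open>\<open>g 0 = 0\<close> lets emptied piles and an empty new pile stay in the sum, so the
  filter and the case distinction in \<open>move\<close> disappear.\<close>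

lemma sum_list_move:
  fixes g :: "nat \<Rightarrow> real"
  assumes "g 0 = 0"
  shows "(\<Sum>h\<leftarrow>move lam ks. g h) = g (sum_list ks) + sum_list (map2 (\<lambda>h k. g (h - k)) lam ks)"
proof -
  have f: "(\<Sum>h\<leftarrow>filter (\<lambda>x. x > 0) xs. g h) = (\<Sum>h\<leftarrow>xs. g h)" for xs
    using assms by (induction xs) auto
  have "(\<Sum>h\<leftarrow>rev (sort xs). g h) = (\<Sum>h\<leftarrow>xs. g h)" for xs
    by (metis mset_map mset_rev mset_sort sum_mset_sum_list)
  moreover have "(\<Sum>h\<leftarrow>(if S > 0 then [S] else []). g h) = g S" for S
    using assms by simp
  ultimately show ?thesis
    by (simp only: move_def map_append sum_list_append f map_map comp_def case_prod_unfold)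
qed

section \<open>Powers with linear growth\<close>

text \<open>The moments of the limit shape determine it, but the powers themselves are not Lipschitz;
  they are continued linearly above height 2, which almost no pile exceeds.\<close>

definition lin_pow :: "nat \<Rightarrow> real \<Rightarrow> real" where
  "lin_pow k z = (if z \<le> 2 then z ^ k else 2 ^ k + real k * 2 ^ (k - 1) * (z - 2))"

definition lin_pow_deriv :: "nat \<Rightarrow> real \<Rightarrow> real" where
  "lin_pow_deriv k z = real k * min z 2 ^ (k - 1)"

text \<open>Mean value bounds from the factorization of \<open>z ^ m - u ^ m\<close>: each of the
  \<open>m\<close> summands of the second factor lies between \<open>u ^ (m - 1)\<close> and
  \<open>z ^ (m - 1)\<close>.\<close>

lemma power_diff_bounds:
  fixes u z :: real
  assumes "0 \<le> u" "u \<le> z"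
  shows "z ^ m - u ^ m \<le> (z - u) * (real m * z ^ (m - 1))"
    and "(z - u) * (real m * u ^ (m - 1)) \<le> z ^ m - u ^ m"
proof -
  have eq: "z ^ m - u ^ m = (z - u) * (\<Sum>i<m. z ^ (m - Suc i) * u ^ i)"
    using power_diff_sumr2 [of u m z] by (metis minus_diff_eq mult_minus_left)
  have "z ^ (m - Suc i) * u ^ i \<le> z ^ (m - 1)" if "i < m" for i
  proof -
    have "z ^ (m - Suc i) * u ^ i \<le> z ^ (m - Suc i) * z ^ i"
      using assms by (intro mult_left_mono power_mono) auto
    then show ?thesis using that by (simp flip: power_add)
  qed
  then have "(\<Sum>i<m. z ^ (m - Suc i) * u ^ i) \<le> (\<Sum>i<m. z ^ (m - 1))"
    by (intro sum_mono) auto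
  then show "z ^ m - u ^ m \<le> (z - u) * (real m * z ^ (m - 1))"
    unfolding eq using assms by (intro mult_left_mono) auto
  have "u ^ (m - 1) \<le> z ^ (m - Suc i) * u ^ i" if "i < m" for i
  proof -
    have "u ^ (m - Suc i) * u ^ i \<le> z ^ (m - Suc i) * u ^ i"
      using assms by (intro mult_right_mono power_mono) auto
    then show ?thesis using that by (simp flip: power_add)
  qed
  then have "(\<Sum>i<m. u ^ (m - 1)) \<le> (\<Sum>i<m. z ^ (m - Suc i) * u ^ i)"
    by (intro sum_mono) auto
  then show "(z - u) * (real m * u ^ (m - 1)) \<le> z ^ m - u ^ m"
    unfolding eq using assms by (intro mult_left_mono) auto
qed

context
  fixes k :: nat
  assumes k: "1 \<le> k"
begin

lemma lin_pow_0: "lin_pow k 0 = 0" and lin_pow_1: "lin_pow k 1 = 1"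
  using k by (auto simp: lin_pow_def)

lemma lin_pow_deriv_bounds:
  assumes "0 \<le> z"
  shows "0 \<le> lin_pow_deriv k z" "lin_pow_deriv k z \<le> real k * 2 ^ (k - 1)"
  using assms by (auto simp: lin_pow_deriv_def intro!: mult_left_mono power_mono)

text \<open>Convexity: the slope of a chord is at most the derivative at its right end. The linear
  continuation keeps the derivative continuous at 2.\<close>

lemma lin_pow_upper:
  assumes "0 \<le> u" "u \<le> z"
  shows "lin_pow k z - lin_pow k u \<le> (z - u) * lin_pow_deriv k z"
proof -
  consider "z \<le> 2" | "u \<le> 2" "2 < z" | "2 < u" by linarith
  then show ?thesis
  proof cases
    case 2
    then show ?thesis
      using power_diff_bounds(1) [of u 2 k] assms
      by (simp add: lin_pow_def lin_pow_deriv_def algebra_simps)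
  qed (use assms power_diff_bounds(1) [of u z k] in
      \<open>auto simp: lin_pow_def lin_pow_deriv_def algebra_simps\<close>)
qed

text \<open>The quadratic error comes from the power bound applied to the derivative: its
  coefficient is the largest second derivative on \<open>[0, 2]\<close>, and above 2 the second
  derivative is 0. For \<open>k = 1\<close> the factor \<open>k - 1\<close> makes the truncated
  exponent harmless.\<close>

lemma lin_pow_lower:
  assumes "0 \<le> u" "u \<le> z"
  shows "(z - u) * lin_pow_deriv k z - (real k * (real (k - 1) * 2 ^ (k - 2))) * (z - u)\<^sup>2
    \<le> lin_pow k z - lin_pow k u"
proof -
  let ?B = "real k * (real (k - 1) * 2 ^ (k - 2))"
  have low: "(z - u) * (real k * z ^ (k - 1)) - ?B * (z - u)\<^sup>2 \<le> z ^ k - u ^ k"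
    if "u \<le> z" "z \<le> 2" for z
  proof -
    have "z ^ (k - 1) - u ^ (k - 1) \<le> (z - u) * (real (k - 1) * z ^ (k - 2))"
      using power_diff_bounds(1) [OF assms(1) that(1), of "k - 1"] by (simp add: numeral_2_eq_2)
    also have "\<dots> \<le> (z - u) * (real (k - 1) * 2 ^ (k - 2))"
      using assms that by (intro mult_left_mono power_mono) auto
    finally have "((z - u) * real k) * (z ^ (k - 1) - u ^ (k - 1))
        \<le> ((z - u) * real k) * ((z - u) * (real (k - 1) * 2 ^ (k - 2)))"
      using that by (intro mult_left_mono) auto
    then show ?thesis
      using power_diff_bounds(2) [OF assms(1) that(1), of k]
      by (simp add: power2_eq_square algebra_simps)
  qed
  consider "z \<le> 2" | "u \<le> 2" "2 < z" | "2 < u" by linarith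
  then show ?thesis
  proof cases
    case 1
    then show ?thesis using low [of z] assms by (simp add: lin_pow_def lin_pow_deriv_def)
  next
    case 2
    have "?B * (2 - u)\<^sup>2 \<le> ?B * (z - u)\<^sup>2"
      using 2 by (intro mult_left_mono power_mono) auto
    then show ?thesis
      using low [of 2] 2 by (simp add: lin_pow_def lin_pow_deriv_def algebra_simps)
  next
    case 3
    then show ?thesis using assms by (simp add: lin_pow_def lin_pow_deriv_def algebra_simps)
  qed
qed

lemma lin_pow_mono:
  assumes "0 \<le> u" "u \<le> z"
  shows "lin_pow k u \<le> lin_pow k z"
proof -
  consider "z \<le> 2" | "u \<le> 2" "2 < z" | "2 < u" by linarith
  then show ?thesis
  proof cases
    case 2
    have "u ^ k \<le> 2 ^ k" using assms 2 by (intro power_mono) auto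
    then show ?thesis using 2 by (simp add: lin_pow_def add_increasing2)
  qed (use assms in \<open>auto simp: lin_pow_def power_mono intro!: mult_left_mono\<close>)
qed

text \<open>Euler's relation \<open>z * f' z = k * f z\<close> is exact for powers. It turns the
  first-order loss of a pile into a multiple of \<open>f\<close> itself, so that the drift of a
  moment closes up in that moment. The linear continuation violates it only above height 2, by at
  most a multiple of \<open>z\<close>.\<close>

lemma lin_pow_euler:
  assumes "0 \<le> z"
  shows "\<bar>z * lin_pow_deriv k z - real k * lin_pow k z\<bar>
    \<le> (if z \<ge> 2 then (real k * (real k * 2 ^ (k - 1))) * z else 0)"
proof (cases "z \<le> 2")
  case True
  have "z * z ^ (k - 1) = z ^ k" using k by (simp flip: power_Suc)
  then have "z * lin_pow_deriv k z = real k * lin_pow k z"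
    using True by (simp add: lin_pow_def lin_pow_deriv_def algebra_simps)
  then show ?thesis using assms by simp
next
  case False
  have two: "(2::real) ^ k = 2 * 2 ^ (k - 1)" using k by (simp flip: power_Suc)
  have "z * lin_pow_deriv k z - real k * lin_pow k z
      = - ((real k * 2 ^ (k - 1)) * ((real k - 1) * (z - 2)))"
    using False by (simp add: lin_pow_def lin_pow_deriv_def two algebra_simps)
  moreover have "0 \<le> (real k * 2 ^ (k - 1)) * ((real k - 1) * (z - 2))"
    using False k by (intro mult_nonneg_nonneg) auto
  moreover have "(real k * 2 ^ (k - 1)) * ((real k - 1) * (z - 2)) \<le> (real k * 2 ^ (k - 1)) * (real k * z)"
    using False k by (intro mult_left_mono mult_mono) auto
  ultimately show ?thesis using False by (simp add: algebra_simps)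
qed

end

text \<open>The coefficient of \<open>second_moment\<close> for \<open>lin_pow k\<close>:
  \<open>L\<close> is the Lipschitz constant, and the other two summands of \<open>D\<close> are the
  constants of \<open>lin_pow_lower\<close> and \<open>lin_pow_euler\<close>. It depends on
  \<open>k\<close> only and stays fixed as \<open>n\<close> grows.\<close>

definition moment_const :: "nat \<Rightarrow> real" where
  "moment_const k = (let L = real k * 2 ^ (k - 1);
     D = L + real k * (real (k - 1) * 2 ^ (k - 2)) + real k * L
     in D + real k * L\<^sup>2 + real k * L * D)"

section \<open>Counting piles\<close>

text \<open>\<open>part\<close> counts from 1, so \<open>part lam (Suc j)\<close> is
  \<open>lam ! j\<close>. As the piles decrease, those from index \<open>j\<close> on stay below
  \<open>y\<close>, and only the first \<open>j\<close> can reach it.\<close>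

lemma length_filter_le_of_part_less:
  assumes "sorted_wrt (\<ge>) lam" "real (Defs.part lam (Suc j)) < y" "0 < y"
  shows "length (filter (\<lambda>h. y \<le> real h) lam) \<le> j"
proof (cases "j < length lam")
  case True
  have "\<not> y \<le> real h" if h: "h \<in> set (drop j lam)" for h
  proof -
    obtain i where i: "h = drop j lam ! i" "i < length (drop j lam)"
      using h by (metis in_set_conv_nth)
    then have "lam ! (j + i) \<le> lam ! j"
      using sorted_wrt_nth_less [OF assms(1), of j "j + i"] by (cases "i = 0") auto
    then have "h \<le> lam ! j" using i by simp
    then show ?thesis using assms(2) True by (simp add: Defs.part_def)
  qed
  then have "filter (\<lambda>h. y \<le> real h) (drop j lam) = []" by (simp add: filter_empty_conv)
  then have "filter (\<lambda>h. y \<le> real h) lam = filter (\<lambda>h. y \<le> real h) (take j lam)"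
    using filter_append [of "\<lambda>h. y \<le> real h" "take j lam" "drop j lam"] by simp
  then show ?thesis
    using length_filter_le [of "\<lambda>h. y \<le> real h" "take j lam"] by simp
next
  case False
  then show ?thesis using length_filter_le [of "\<lambda>h. y \<le> real h" lam] by linarith
qed

lemma length_filter_gt_of_part_ge:
  assumes "sorted_wrt (\<ge>) lam" "y \<le> real (Defs.part lam (Suc j))" "0 < y"
  shows "j < length (filter (\<lambda>h. y \<le> real h) lam)"
proof -
  \<comment> \<open>Beyond the last pile \<open>part\<close> has the default value 0, which is below
    the positive \<open>y\<close>.\<close>
  have j: "j < length lam"
  proof (rule ccontr)
    assume "\<not> j < length lam"
    then have "Defs.part lam (Suc j) = 0" by (simp add: Defs.part_def)
    then show False using assms by simp
  qed
  have "y \<le> real h" if h: "h \<in> set (take (Suc j) lam)" for h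
  proof -
    obtain i where "h = take (Suc j) lam ! i" "i < length (take (Suc j) lam)"
      using h by (metis in_set_conv_nth)
    then have i: "h = lam ! i" "i \<le> j" "i < length lam" by auto
    then have "lam ! j \<le> h"
      using sorted_wrt_nth_less [OF assms(1), of i j] j by (cases "i = j") auto
    then show ?thesis using assms(2) j by (simp add: Defs.part_def)
  qed
  then have "filter (\<lambda>h. y \<le> real h) (take (Suc j) lam) = take (Suc j) lam"
    by (simp add: filter_id_conv)
  then have "length (filter (\<lambda>h. y \<le> real h) lam)
      = Suc j + length (filter (\<lambda>h. y \<le> real h) (drop (Suc j) lam))"
    using j filter_append [of "\<lambda>h. y \<le> real h" "take (Suc j) lam" "drop (Suc j) lam"] by simp
  then show ?thesis by simp
qed

text \<open>A continuous substitute for \<open>1 / z\<close> on \<open>[a, \<infinity>)\<close>, cut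
  off to 0 below \<open>b\<close>, so that \<open>z * ramp b a z\<close> lies between the indicators
  of \<open>z \<ge> a\<close> and \<open>z \<ge> b\<close>. The maximum in the denominator keeps it
  away from 0.\<close>

definition ramp :: "real \<Rightarrow> real \<Rightarrow> real \<Rightarrow> real" where
  "ramp b a z = min 1 (max 0 ((z - b) / (a - b))) / max z b"

lemma sum_list_indicator: "(\<Sum>h\<leftarrow>xs. if P h then 1 else 0 :: real) = real (length (filter P xs))"
  by (induction xs) auto

lemma integral_inverse:
  assumes "0 < c" "c \<le> 1"
  shows "((\<lambda>z. 1 / z) has_integral - ln c) {c..1::real}"
proof -
  have "((\<lambda>z. 1 / z) has_integral ln 1 - ln c) {c..1}"
  proof (rule fundamental_theorem_of_calculus)
    fix x assume "x \<in> {c..1}"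
    then have "(ln has_real_derivative 1 / x) (at x within {c..1})"
      using assms by (auto intro!: derivative_eq_intros)
    then show "(ln has_vector_derivative 1 / x) (at x within {c..1})"
      by (simp add: has_real_derivative_iff_has_vector_derivative)
  qed (use assms in auto)
  then show ?thesis by simp
qed

context
  fixes a b :: real
  assumes b: "0 < b" and ba: "b < a"
begin

lemma continuous_on_ramp: "continuous_on S (ramp b a)"
  unfolding ramp_def using b ba by (intro continuous_intros) auto

lemma ramp_nonneg: "0 \<le> ramp b a z"
  unfolding ramp_def using b by (intro divide_nonneg_nonneg) auto

lemma ramp_le: "ramp b a z \<le> 1 / max z b"
  unfolding ramp_def using b by (intro divide_right_mono) auto

lemma ramp_eq_0: "z \<le> b \<Longrightarrow> ramp b a z = 0"
  using ba divide_nonpos_pos [of "z - b" "a - b"] by (simp add: ramp_def max_absorb1)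

lemma ramp_eq: "a \<le> z \<Longrightarrow> ramp b a z = 1 / z"
  using b ba by (simp add: ramp_def max_def)

lemma ramp_bounds:
  assumes "0 \<le> z"
  shows "z * ramp b a z \<le> (if b \<le> z then 1 else 0)" "(if a \<le> z then 1 else 0) \<le> z * ramp b a z"
proof -
  have "z * ramp b a z \<le> 1" if "b \<le> z"
    using mult_left_mono [OF ramp_le assms, of z] that b by (simp add: max_def)
  then show "z * ramp b a z \<le> (if b \<le> z then 1 else 0)" using ramp_eq_0 [of z] by auto
  show "(if a \<le> z then 1 else 0) \<le> z * ramp b a z"
    using ramp_eq [of z] ramp_nonneg [of z] assms b ba by auto
qed

text \<open>On \<open>[b, 1]\<close> the ramp is below \<open>1 / z\<close>. The maximum with 0
  covers \<open>b > 1\<close>, where the ramp vanishes on the whole unit interval; this happens for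
  small \<open>x\<close> in the final choice of \<open>b\<close>.\<close>

lemma integral_ramp_le: "integral {0..1} (ramp b a) \<le> max 0 (- ln b)"
proof (cases "b \<le> 1")
  case True
  note int = integrable_continuous_interval [OF continuous_on_ramp]
  have "integral {0..1} (ramp b a) = integral {0..b} (ramp b a) + integral {b..1} (ramp b a)"
    using b True by (intro Henstock_Kurzweil_Integration.integral_combine [symmetric] int) auto
  also have "integral {0..b} (ramp b a) = integral {0..b} (\<lambda>_. 0)"
    by (rule integral_cong) (simp add: ramp_eq_0)
  also have "integral {b..1} (ramp b a) \<le> - ln b"
  proof (rule has_integral_le [OF integrable_integral [OF int] integral_inverse [OF b True]])
    fix z assume "z \<in> {b..1}"
    then show "ramp b a z \<le> 1 / z" using ramp_le [of z] by (simp add: max_absorb1)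
  qed
  finally show ?thesis by simp
next
  case False
  have "integral {0..1} (ramp b a) = integral {0..1} (\<lambda>_::real. 0 :: real)"
    by (rule integral_cong) (use False in \<open>simp add: ramp_eq_0\<close>)
  then show ?thesis by simp
qed

lemma integral_ramp_ge:
  assumes "a \<le> 1"
  shows "- ln a \<le> integral {0..1} (ramp b a)"
proof -
  note int = integrable_continuous_interval [OF continuous_on_ramp]
  have "- ln a = integral {a..1} (\<lambda>z. 1 / z)"
    using integral_inverse [of a] assms b ba by (simp add: integral_unique)
  also have "\<dots> = integral {a..1} (ramp b a)"
    by (rule integral_cong) (simp add: ramp_eq)
  also have "\<dots> \<le> integral {0..1} (ramp b a)"
    using b ba ramp_nonneg by (intro integral_subset_le int) auto
  finally show ?thesis .
qed

end

section \<open>The stationary chain\<close>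

locale stationary_solitaire =
  fixes p q :: real and n :: nat and \<pi> :: "nat list \<Rightarrow> real"
  assumes p_pos: "0 < p" and p_le: "p \<le> 1" and q_pos: "0 < q" and q_le: "q \<le> 1"
    and n_ge: "1 \<le> n" and stat: "stationary p q n \<pi>"
begin

text \<open>In the scaled picture, a pile of \<open>h\<close> cards has height \<open>h / N\<close> and width \<open>s\<close>.\<close>

definition s :: real where "s = p * q"
definition N :: real where "N = p * q * real n"

definition expc :: "(nat list \<Rightarrow> real) \<Rightarrow> real" where
  "expc F = (\<Sum>lam\<in>partitions n. \<pi> lam * F lam)"

text \<open>Rounding up adds at most one candidate per pile, hence at most \<open>p\<close> to the
  mean of the new pile; this is the total, relative to \<open>N\<close>.\<close>

definition excess :: "nat list \<Rightarrow> real" where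
  "excess lam = p * real (length lam) / N"

definition dev :: "nat list \<Rightarrow> real" where
  "dev lam = pick_exp p q lam (\<lambda>ks. \<bar>real (sum_list ks) / N - 1\<bar>)"

text \<open>As \<open>s * (h / N) = h / n\<close>, this is the proportion of all cards lying in
  piles of height at least 2.\<close>

definition tail :: "nat list \<Rightarrow> real" where
  "tail lam = s * (\<Sum>h\<leftarrow>lam. if real h / N \<ge> 2 then real h / N else 0)"

definition lin :: "(real \<Rightarrow> real) \<Rightarrow> nat list \<Rightarrow> real" where
  "lin f lam = (\<Sum>h\<leftarrow>lam. f (real h / N))"

lemma s_pos: "0 < s" and N_pos: "0 < N" and s_le: "s \<le> 1" and N_eq: "N = s * real n"
  using p_pos q_pos n_ge p_le q_le by (auto simp: s_def N_def mult_le_one)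

lemma \<pi>_nonneg: "lam \<in> partitions n \<Longrightarrow> 0 \<le> \<pi> lam"
  using stat unfolding stationary_def by blast

lemma \<pi>_total: "(\<Sum>lam\<in>partitions n. \<pi> lam) = 1"
  using stat unfolding stationary_def by blast

lemma expc_const [simp]: "expc (\<lambda>lam. a) = a"
  using \<pi>_total sum_distrib_right [of \<pi> "partitions n" a, symmetric] by (simp add: expc_def)

lemma expc_add: "expc (\<lambda>lam. F lam + G lam) = expc F + expc G"
  by (simp add: expc_def sum.distrib algebra_simps)

lemma expc_diff: "expc (\<lambda>lam. F lam - G lam) = expc F - expc G"
  by (simp add: expc_def sum_subtractf algebra_simps)

lemma expc_cmult: "expc (\<lambda>lam. a * F lam) = a * expc F"
  by (simp add: expc_def sum_distrib_left algebra_simps)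

lemma expc_mono:
  assumes "\<And>lam. lam \<in> partitions n \<Longrightarrow> F lam \<le> G lam"
  shows "expc F \<le> expc G"
  unfolding expc_def using assms by (intro sum_mono mult_left_mono) (auto simp: \<pi>_nonneg)

lemma expc_cong:
  assumes "\<And>lam. lam \<in> partitions n \<Longrightarrow> F lam = G lam"
  shows "expc F = expc G"
  unfolding expc_def using assms by (intro sum.cong) auto

text \<open>Stationarity tested against \<open>F\<close>: \<open>trans_prob\<close> groups the pick
  vectors by the partition they lead to, so averaging over targets equals averaging over
  picks.\<close>

lemma expc_move: "expc F = expc (\<lambda>lam. pick_exp p q lam (\<lambda>ks. F (move lam ks)))"
proof -
  have "expc F = (\<Sum>mu\<in>partitions n. \<Sum>lam\<in>partitions n. \<pi> lam * (trans_prob p q lam mu * F mu))"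
    unfolding expc_def
  proof (intro sum.cong refl)
    fix mu assume "mu \<in> partitions n"
    then have "\<pi> mu = (\<Sum>lam\<in>partitions n. \<pi> lam * trans_prob p q lam mu)"
      using stat unfolding stationary_def by blast
    then show "\<pi> mu * F mu = (\<Sum>lam\<in>partitions n. \<pi> lam * (trans_prob p q lam mu * F mu))"
      by (simp add: sum_distrib_right mult.assoc)
  qed
  also have "\<dots> = (\<Sum>lam\<in>partitions n. \<pi> lam * (\<Sum>mu\<in>partitions n. trans_prob p q lam mu * F mu))"
    by (subst sum.swap) (simp add: sum_distrib_left)
  also have "\<dots> = expc (\<lambda>lam. pick_exp p q lam (\<lambda>ks. F (move lam ks)))"
    unfolding expc_def
  proof (intro sum.cong refl arg_cong2 [where f = "(*)"])
    fix lam assume lam: "lam \<in> partitions n"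
    have "(\<Sum>mu\<in>partitions n. trans_prob p q lam mu * F mu)
        = (\<Sum>mu\<in>partitions n. \<Sum>ks\<in>{ks\<in>picks q lam. move lam ks = mu}.
             pick_prob p q lam ks * F (move lam ks))"
      unfolding trans_prob_def sum_distrib_right by (intro sum.cong) auto
    also have "\<dots> = pick_exp p q lam (\<lambda>ks. F (move lam ks))"
      unfolding pick_exp_def
      by (rule sum.group) (use move_in_partitions [OF lam _ q_le] in auto)
    finally show "(\<Sum>mu\<in>partitions n. trans_prob p q lam mu * F mu)
        = pick_exp p q lam (\<lambda>ks. F (move lam ks))" .
  qed
  finally show ?thesis .
qed

section \<open>Balance of gains and losses for additive potentials\<close>

lemma pick_exp_sum_list_move:
  fixes g :: "nat \<Rightarrow> real"
  assumes "g 0 = 0"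
  shows "pick_exp p q lam (\<lambda>ks. \<Sum>h\<leftarrow>move lam ks. g h) - (\<Sum>h\<leftarrow>lam. g h)
     = pick_exp p q lam (\<lambda>ks. g (sum_list ks))
       - (\<Sum>h\<leftarrow>lam. bin_exp p (cand q h) (\<lambda>k. g h - g (h - k)))"
  by (simp add: sum_list_move [of g, OF assms] pick_exp_add pick_exp_sum_map2 bin_exp_diff sum_list_subtractf)

text \<open>In the stationary state what the new pile brings in equals, in mean, what the old piles
  lose. It is applied to harmonic numbers and to a truncated height.\<close>

lemma balance:
  fixes g :: "nat \<Rightarrow> real"
  assumes "g 0 = 0"
  shows "expc (\<lambda>lam. pick_exp p q lam (\<lambda>ks. g (sum_list ks)))
     = expc (\<lambda>lam. \<Sum>h\<leftarrow>lam. bin_exp p (cand q h) (\<lambda>k. g h - g (h - k)))"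
proof -
  have "expc (\<lambda>lam. pick_exp p q lam (\<lambda>ks. \<Sum>h\<leftarrow>move lam ks. g h) - (\<Sum>h\<leftarrow>lam. g h)) = 0"
    by (simp add: expc_diff expc_move [of "\<lambda>lam. \<Sum>h\<leftarrow>lam. g h"])
  then show ?thesis
    by (simp add: pick_exp_sum_list_move [of g, OF assms] expc_diff)
qed

section \<open>The mean number of piles\<close>

lemma sum_picks_le:
  assumes "lam \<in> partitions n" "ks \<in> picks q lam"
  shows "sum_list ks \<le> n"
  using sum_list_map2_diff [OF assms(2) q_le] assms(1) by (simp add: partitions_def)

text \<open>With \<open>harm\<close> as potential, a pick of \<open>k\<close> cards from a pile of
  \<open>h\<close> costs at least \<open>k / h\<close>, so each pile loses at least \<open>s\<close>
  in mean, whatever its size. The new pile gains at most \<open>harm n\<close>, which is at most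
  \<open>1 + ln n\<close>; the balance bounds the mean number of piles.\<close>

lemma expc_excess_le: "expc excess \<le> (1 + ln (real n)) / (p * q\<^sup>2 * real n)"
proof -
  define H :: "nat \<Rightarrow> real" where "H = harm"
  have H0: "H 0 = 0" by (simp add: H_def harm_def)
  have Hle: "H k \<le> 1 + ln (real n)" if "k \<le> n" for k
  proof -
    have "H k \<le> H n" using that by (auto simp: H_def intro: harm_mono)
    \<comment> \<open>The difference of \<open>harm\<close> and \<open>ln\<close> decreases from its
      first value 1; that sequence is indexed from 0, hence \<open>n - 1\<close>.\<close>
    also have "H n - ln n \<le> 1"
      using decseqD [OF decseq_harm_diff_ln, of 0 "n - 1"] n_ge by (simp add: H_def harm_def)
    then have "H n \<le> 1 + ln (real n)" by simp
    finally show ?thesis .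
  qed
  \<comment> \<open>The \<open>k\<close> reciprocals removed from the harmonic sum are each at least
    \<open>1 / h\<close>.\<close>
  have Hdrop: "real k * (1 / real h) \<le> H h - H (h - k)" if "k \<le> h" for h k
    using that
  proof (induction k)
    case (Suc k)
    then have "Suc (h - Suc k) = h - k" by simp
    then have "H (h - k) = H (h - Suc k) + 1 / real (h - k)"
      using harm_Suc [of "h - Suc k", where 'a = real] by (simp add: H_def field_simps)
    moreover have "1 / real h \<le> 1 / real (h - k)"
      using Suc.prems by (intro divide_left_mono) auto
    ultimately show ?case using Suc by (simp add: algebra_simps add_divide_distrib)
  qed auto
  have "expc (\<lambda>lam. s * real (length lam))
      \<le> expc (\<lambda>lam. \<Sum>h\<leftarrow>lam. bin_exp p (cand q h) (\<lambda>k. H h - H (h - k)))"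
  proof (rule expc_mono)
    fix lam assume lam: "lam \<in> partitions n"
    have "(\<Sum>h\<leftarrow>lam. s) \<le> (\<Sum>h\<leftarrow>lam. bin_exp p (cand q h) (\<lambda>k. H h - H (h - k)))"
    proof (rule sum_list_mono)
      fix h assume "h \<in> set lam"
      then have h: "h > 0" using lam by (auto simp: partitions_def intro: gr0I)
      have "s = p * (q * real h) * (1 / real h)" using h by (simp add: s_def)
      also have "\<dots> \<le> p * cand q h * (1 / real h)"
        using cand_bounds [of q h] p_pos q_pos by (intro mult_right_mono mult_left_mono) auto
      also have "\<dots> = bin_exp p (cand q h) (\<lambda>k. real k * (1 / real h))"
        using bin_exp_cmult [of p _ "1 / real h" real] by (simp add: bin_exp_id mult.commute)
      also have "\<dots> \<le> bin_exp p (cand q h) (\<lambda>k. H h - H (h - k))"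
        using p_pos p_le cand_le [OF q_le, of h] by (intro bin_exp_mono Hdrop) auto
      finally show "s \<le> bin_exp p (cand q h) (\<lambda>k. H h - H (h - k))" .
    qed
    then show "s * real (length lam) \<le> (\<Sum>h\<leftarrow>lam. bin_exp p (cand q h) (\<lambda>k. H h - H (h - k)))"
      by (simp add: sum_list_triv mult.commute)
  qed
  also have "\<dots> = expc (\<lambda>lam. pick_exp p q lam (\<lambda>ks. H (sum_list ks)))"
    by (rule balance [of H, symmetric, OF H0])
  also have "\<dots> \<le> expc (\<lambda>lam. pick_exp p q lam (\<lambda>ks. 1 + ln (real n)))"
    using p_pos p_le by (intro expc_mono pick_exp_mono Hle sum_picks_le) auto
  finally have "s * expc (\<lambda>lam. real (length lam)) \<le> 1 + ln (real n)"
    by (simp add: expc_cmult)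
  moreover have "expc excess = (p / (N * s)) * (s * expc (\<lambda>lam. real (length lam)))"
    using s_pos N_pos expc_cmult [of "p / N" "\<lambda>lam. real (length lam)"]
    by (simp add: excess_def [abs_def])
  ultimately have "expc excess \<le> (p / (N * s)) * (1 + ln (real n))"
    using p_pos s_pos N_pos by (simp add: mult_left_mono del: times_divide_eq_left)
  also have "\<dots> = (1 + ln (real n)) / (p * q\<^sup>2 * real n)"
    using p_pos q_pos n_ge by (simp add: N_def s_def field_simps power2_eq_square)
  finally show ?thesis .
qed

section \<open>The height of the new pile\<close>

lemma excess_nonneg: "0 \<le> excess lam"
  using p_pos N_pos by (simp add: excess_def)

lemma pick_mean_bounds:
  assumes "lam \<in> partitions n"
  shows "N \<le> pick_mean p q lam" "pick_mean p q lam \<le> N * (1 + excess lam)"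
proof -
  have N: "N = (\<Sum>h\<leftarrow>lam. s * real h)"
    using assms sum_list_of_nat [of lam, where 'a = real]
    by (simp add: N_eq sum_list_const_mult partitions_def)
  show "N \<le> pick_mean p q lam"
    unfolding N pick_mean_def s_def using cand_bounds p_pos q_pos
    by (intro sum_list_mono) (auto simp: mult.assoc)
  have "pick_mean p q lam \<le> (\<Sum>h\<leftarrow>lam. s * real h + p)"
    unfolding pick_mean_def
  proof (intro sum_list_mono)
    fix h
    have "p * real (cand q h) \<le> p * (q * real h + 1)"
      using cand_bounds [of q h] p_pos q_pos by (intro mult_left_mono) auto
    then show "p * real (cand q h) \<le> s * real h + p" by (simp add: s_def algebra_simps)
  qed
  also have "\<dots> = N * (1 + excess lam)"
    using N N_pos by (simp add: sum_list_addf sum_list_triv excess_def algebra_simps)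
  finally show "pick_mean p q lam \<le> N * (1 + excess lam)" .
qed

lemma dev_nonneg: "0 \<le> dev lam"
  unfolding dev_def using pick_exp_mono [of p q lam "\<lambda>_. 0"] p_pos p_le by simp

text \<open>Bias plus fluctuation: the mean of the new pile exceeds \<open>N\<close> by at most
  \<open>N * excess lam\<close>, and the fluctuation is controlled by the variance.\<close>

lemma dev_le:
  assumes lam: "lam \<in> partitions n"
  shows "dev lam \<le> excess lam + (1 + excess lam) / sqrt N"
proof -
  let ?m = "pick_mean p q lam"
  note m = pick_mean_bounds [OF lam]
  have "N * dev lam = pick_exp p q lam (\<lambda>ks. \<bar>real (sum_list ks) - N\<bar>)"
    unfolding dev_def pick_exp_cmult [symmetric]
  proof (rule pick_exp_cong)
    fix ks
    have "real (sum_list ks) - N = N * (real (sum_list ks) / N - 1)"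
      using N_pos by (simp add: field_simps)
    then show "N * \<bar>real (sum_list ks) / N - 1\<bar> = \<bar>real (sum_list ks) - N\<bar>"
      using N_pos by (simp add: abs_mult)
  qed
  also have "\<dots> \<le> pick_exp p q lam (\<lambda>ks. \<bar>real (sum_list ks) - ?m\<bar> + N * excess lam)"
    using p_pos p_le m by (intro pick_exp_mono) (auto simp: algebra_simps)
  also have "\<dots> \<le> (?m / sqrt N + sqrt N) / 2 + N * excess lam"
    using pick_exp_abs_dev_le [of p "sqrt N" q lam] p_pos p_le N_pos
    by (simp add: pick_exp_add)
  \<comment> \<open>Both halves are raised to the common bound
    \<open>N * (1 + excess lam) / sqrt N\<close>.\<close>
  also have "\<dots> \<le> (N * (1 + excess lam) / sqrt N + N * (1 + excess lam) / sqrt N) / 2 + N * excess lam"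
  proof -
    have "sqrt N = N * 1 / sqrt N" using N_pos by (simp add: real_div_sqrt)
    also have "\<dots> \<le> N * (1 + excess lam) / sqrt N"
      using N_pos excess_nonneg [of lam] by (intro divide_right_mono mult_left_mono) auto
    finally show ?thesis
      using m N_pos by (intro add_right_mono divide_right_mono add_mono) auto
  qed
  also have "\<dots> = N * (excess lam + (1 + excess lam) / sqrt N)"
    by (simp add: algebra_simps add_divide_distrib)
  finally show ?thesis using N_pos by simp
qed

section \<open>The mass of high piles\<close>

lemma tail_nonneg: "0 \<le> tail lam"
  unfolding tail_def using s_pos N_pos by (intro mult_nonneg_nonneg sum_list_nonneg) auto

text \<open>The potential vanishes up to height \<open>3/2\<close>, so a new pile of height
  \<open>Z\<close> gains at most \<open>\<bar>Z - 1\<bar>\<close>, while a pile of height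
  \<open>z \<ge> 2\<close> loses at least \<open>s * (z - 3/2)\<close> in mean.\<close>

lemma expc_tail_le: "expc tail \<le> 4 * expc dev"
proof -
  define f :: "real \<Rightarrow> real" where "f z = max 0 (z - 3/2)" for z
  define g where "g h = f (real h / N)" for h :: nat
  have g0: "g 0 = 0" by (simp add: g_def f_def)
  \<comment> \<open>This is convexity together with \<open>f 0 = 0\<close>: shrinking a pile shrinks
    its potential at least in proportion.\<close>
  have shrink: "f (y * (1 - t)) \<le> f y * (1 - t)" if "2 \<le> y" "0 \<le> t" "t \<le> 1" for y t
    using that mult_nonneg_nonneg [of "y - 3/2" "1 - t"] by (simp add: f_def max_def algebra_simps)
  have "expc (\<lambda>lam. 1/4 * tail lam)
      \<le> expc (\<lambda>lam. \<Sum>h\<leftarrow>lam. bin_exp p (cand q h) (\<lambda>k. g h - g (h - k)))"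
  proof (rule expc_mono)
    fix lam
    show "1/4 * tail lam \<le> (\<Sum>h\<leftarrow>lam. bin_exp p (cand q h) (\<lambda>k. g h - g (h - k)))"
      unfolding tail_def sum_list_const_mult [symmetric]
    proof (rule sum_list_mono)
      fix h :: nat
      let ?z = "real h / N"
      show "1/4 * (s * (if 2 \<le> ?z then ?z else 0))
          \<le> bin_exp p (cand q h) (\<lambda>k. g h - g (h - k))"
      proof (cases "2 \<le> ?z")
        case True
        then have h: "h > 0" by (intro gr0I) auto
        have fz: "f ?z = ?z - 3/2" using True by (simp add: f_def)
        \<comment> \<open>\<open>z / 4 \<le> z - 3/2\<close> holds exactly for
          \<open>z \<ge> 2\<close>; this is the source of the factor 4.\<close>
        have "1/4 * (s * ?z) \<le> s * f ?z"
          using True s_pos mult_left_mono [of "1/4 * ?z" "?z - 3/2" s] by (simp add: fz algebra_simps)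
        also have "\<dots> = p * (q * real h) * (f ?z / real h)" using h by (simp add: s_def)
        also have "\<dots> \<le> p * cand q h * (f ?z / real h)"
          using cand_bounds [of q h] p_pos q_pos
          by (intro mult_right_mono mult_left_mono) (auto simp: f_def)
        also have "\<dots> = bin_exp p (cand q h) (\<lambda>k. (f ?z / real h) * real k)"
          unfolding bin_exp_cmult bin_exp_id by simp
        also have "\<dots> \<le> bin_exp p (cand q h) (\<lambda>k. g h - g (h - k))"
        proof (rule bin_exp_mono)
          fix k assume "k \<le> cand q h"
          then have k: "k \<le> h" using cand_le [OF q_le, of h] by simp
          have "f ?z / real h * real k = f ?z * (real k / real h)" by simp
          moreover have "real (h - k) / N = ?z * (1 - real k / real h)"
            using k h by (simp add: of_nat_diff right_diff_distrib diff_divide_distrib)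
          moreover have "f (?z * (1 - real k / real h)) \<le> f ?z * (1 - real k / real h)"
            using True k h by (intro shrink) auto
          ultimately show "f ?z / real h * real k \<le> g h - g (h - k)"
            by (simp only: g_def right_diff_distrib mult_1_right)
        qed (use p_pos p_le in auto)
        finally show ?thesis using True by simp
      next
        case False
        have "real (h - k) / N \<le> real h / N" for k
          using N_pos by (intro divide_right_mono) auto
        then have "g (h - k) \<le> g h" for k
          unfolding g_def f_def by (intro max.mono diff_right_mono) auto
        then have "bin_exp p (cand q h) (\<lambda>k. 0) \<le> bin_exp p (cand q h) (\<lambda>k. g h - g (h - k))"
          using p_pos p_le by (intro bin_exp_mono) auto
        then show ?thesis using False by simp
      qed
    qed
  qed
  also have "\<dots> = expc (\<lambda>lam. pick_exp p q lam (\<lambda>ks. g (sum_list ks)))"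
    by (rule balance [of g, symmetric, OF g0])
  also have "\<dots> \<le> expc dev"
    unfolding dev_def using p_pos p_le
    by (intro expc_mono pick_exp_mono) (auto simp: g_def f_def)
  finally show ?thesis by (simp only: expc_cmult)
qed

section \<open>Drift and mean square of a moment\<close>

lemma sum_scaled_heights:
  assumes "lam \<in> partitions n"
  shows "(\<Sum>h\<leftarrow>lam. s * (real h / N)) = 1"
proof -
  have "(\<Sum>h\<leftarrow>lam. real h) = real n"
    using assms sum_list_of_nat [of lam, where 'a = real] by (simp add: partitions_def)
  moreover have "(\<Sum>h\<leftarrow>lam. s * (real h / N)) = (\<Sum>h\<leftarrow>lam. (s / N) * real h)"
    by simp
  moreover have "(s / N) * real n = 1"
    using s_pos n_ge by (simp add: N_eq)
  ultimately show ?thesis by (simp only: sum_list_const_mult)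
qed

text \<open>One error for all purposes: the terms before \<open>dev\<close> are the sum over the
  piles of the bound in \<open>pile_drop\<close>, and \<open>2 * dev lam\<close> serves both the new
  pile in \<open>drift\<close> and the squared increment in \<open>second_moment\<close>.\<close>

definition err :: "nat list \<Rightarrow> real" where
  "err lam = (4 * s + 1 / N) + 2 * tail lam + 3 * excess lam + 2 * dev lam"

lemma err_nonneg: "0 \<le> err lam"
  unfolding err_def using s_pos N_pos tail_nonneg [of lam] excess_nonneg [of lam] dev_nonneg [of lam]
  by (intro add_nonneg_nonneg) auto

text \<open>The assumptions abstract from \<open>lin_pow k\<close>: \<open>d\<close> acts as
  derivative of \<open>f\<close>, \<open>L\<close> bounds it, \<open>B\<close> is the second-order
  constant and \<open>C\<close> measures the defect of Euler's relation.\<close>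

context
  fixes f d :: "real \<Rightarrow> real" and L B C k :: real
  assumes N_ge: "1 \<le> N"
    and f0: "f 0 = 0" and f1: "f 1 = 1"
    and mono: "\<And>u z. 0 \<le> u \<Longrightarrow> u \<le> z \<Longrightarrow> f u \<le> f z"
    and upper: "\<And>u z. 0 \<le> u \<Longrightarrow> u \<le> z \<Longrightarrow> f z - f u \<le> (z - u) * d z"
    and lower: "\<And>u z. 0 \<le> u \<Longrightarrow> u \<le> z \<Longrightarrow> (z - u) * d z - B * (z - u)\<^sup>2 \<le> f z - f u"
    and d_nonneg: "\<And>z. 0 \<le> z \<Longrightarrow> 0 \<le> d z" and d_le: "\<And>z. 0 \<le> z \<Longrightarrow> d z \<le> L"
    and euler: "\<And>z. 0 \<le> z \<Longrightarrow> \<bar>z * d z - k * f z\<bar> \<le> (if z \<ge> 2 then C * z else 0)"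
    and B_nonneg: "0 \<le> B" and C_nonneg: "0 \<le> C"
begin

lemma L_nonneg: "0 \<le> L"
  using d_nonneg [of 0] d_le [of 0] by simp

lemma lipschitz: "0 \<le> x \<Longrightarrow> 0 \<le> y \<Longrightarrow> \<bar>f x - f y\<bar> \<le> L * \<bar>x - y\<bar>"
proof (induction x y rule: linorder_wlog)
  case (le x y)
  then have "f y - f x \<le> (y - x) * L"
    using upper [of x y] mult_left_mono [OF d_le [of y], of "y - x"] by simp
  then show ?case using le mono [of x y] by (simp add: mult.commute)
qed (simp add: abs_minus_commute)

lemma f_bounds: "0 \<le> z \<Longrightarrow> 0 \<le> f z" "0 \<le> z \<Longrightarrow> f z \<le> L * z"
  using mono [of 0 z] lipschitz [of z 0] f0 by auto

text \<open>The loss of height has mean \<open>s * z\<close> up to rounding, so to first order the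
  potential drops by \<open>s * z * d z\<close>, which Euler's relation turns into
  \<open>k * s * f z\<close>. Rounding costs a multiple of \<open>L\<close>, the second-order term
  of \<open>B\<close>, the defect of Euler's relation of \<open>C\<close>.\<close>

lemma pile_drop:
  assumes "h \<le> n"
  defines "z \<equiv> real h / N"
  shows "\<bar>bin_exp p (cand q h) (\<lambda>j. f (real h / N) - f (real (h - j) / N)) - k * (s * f z)\<bar>
    \<le> (L + B + C) * ((4 * s + 1 / N) * (s * z) + 2 * (s * (if z \<ge> 2 then z else 0)) + 3 * (p / N))"
    (is "\<bar>?D - _\<bar> \<le> (L + B + C) * ?e")
proof -
  have z: "0 \<le> z" using N_pos by (simp add: z_def)
  have sz: "s * z \<le> 1"
    using assms(1) s_pos n_ge by (simp add: z_def N_eq)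
  \<comment> \<open>The mean loss of height, with the rounding included.\<close>
  define c where "c = p * real (cand q h) / N"
  have c: "s * z \<le> c" "c \<le> s * z + p / N"
  proof -
    have "p * (q * real h) / N \<le> c" "c \<le> p * (q * real h + 1) / N"
      unfolding c_def using cand_bounds [of q h] p_pos q_pos N_pos
      by (intro divide_right_mono mult_left_mono; simp)+
    then show "s * z \<le> c" "c \<le> s * z + p / N"
      by (auto simp: z_def s_def algebra_simps add_divide_distrib)
  qed
  have pN: "0 \<le> p / N" "p / N \<le> 1" using p_pos p_le N_pos N_ge by auto
  have szn: "0 \<le> s * z" using s_pos z by simp
  have u: "real (h - j) / N = z - real j / N" "0 \<le> real (h - j) / N" if "j \<le> cand q h" for j
    using that cand_le [OF q_le, of h] N_pos by (auto simp: z_def of_nat_diff diff_divide_distrib divide_right_mono)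
  have "?D \<le> bin_exp p (cand q h) (\<lambda>j. (d z / N) * real j)"
  proof (rule bin_exp_mono)
    fix j assume "j \<le> cand q h"
    then show "f (real h / N) - f (real (h - j) / N) \<le> (d z / N) * real j"
      using upper [of "real (h - j) / N" z] u [of j] N_pos by (simp add: z_def field_simps)
  qed (use p_pos p_le in auto)
  also have "\<dots> = c * d z"
    unfolding bin_exp_cmult bin_exp_id by (simp add: c_def)
  finally have D_le: "?D \<le> c * d z" .
  \<comment> \<open>The second moment of a binomial variable is its squared mean plus a variance of
    at most its mean; in units of \<open>N\<close> these are \<open>c\<^sup>2\<close> and
    \<open>c / N\<close>.\<close>
  have "c * d z - B * (c\<^sup>2 + c / N) \<le> (d z / N) * (p * real (cand q h))
      - (B / N\<^sup>2) * ((p * real (cand q h))\<^sup>2 + p * (1 - p) * real (cand q h))"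
  proof -
    have "p * (1 - p) * real (cand q h) \<le> p * 1 * real (cand q h)"
      using p_pos by (intro mult_right_mono mult_left_mono) auto
    then have "(B / N\<^sup>2) * ((p * real (cand q h))\<^sup>2 + p * (1 - p) * real (cand q h))
       \<le> (B / N\<^sup>2) * ((p * real (cand q h))\<^sup>2 + p * 1 * real (cand q h))"
      using B_nonneg by (intro mult_left_mono add_left_mono) auto
    also have "\<dots> = B * (c\<^sup>2 + c / N)"
      using N_pos by (simp add: c_def field_simps power2_eq_square)
    finally show ?thesis by (simp add: c_def mult.commute)
  qed
  also have "\<dots> = bin_exp p (cand q h) (\<lambda>j. (d z / N) * real j - (B / N\<^sup>2) * (real j)\<^sup>2)"
    unfolding bin_exp_diff bin_exp_cmult bin_exp_id bin_exp_square ..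
  also have "\<dots> \<le> ?D"
  proof (rule bin_exp_mono)
    fix j assume "j \<le> cand q h"
    then show "(d z / N) * real j - (B / N\<^sup>2) * (real j)\<^sup>2 \<le> f (real h / N) - f (real (h - j) / N)"
      using lower [of "real (h - j) / N" z] u [of j] N_pos
      by (simp add: z_def power_divide mult.commute)
  qed (use p_pos p_le in auto)
  finally have D_ge: "c * d z - B * (c\<^sup>2 + c / N) \<le> ?D" .
  \<comment> \<open>For \<open>z < 2\<close> one factor \<open>z\<close> is replaced by 2; for
    \<open>z \<ge> 2\<close> one factor \<open>s * z \<le> 1\<close> is dropped and the rest is
    charged to the tail.\<close>
  have sz2: "(s * z)\<^sup>2 \<le> 2 * s * (s * z) + s * (if z \<ge> 2 then z else 0)"
  proof (cases "z \<ge> 2")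
    case True
    have "(s * z) * (s * z) \<le> 1 * (s * z)"
      using sz szn by (intro mult_right_mono)
    then show ?thesis using True s_pos szn by (simp add: power2_eq_square add_increasing)
  next
    case False
    have "z * (s * (s * z)) \<le> 2 * (s * (s * z))"
      using False szn s_pos by (intro mult_right_mono) auto
    then show ?thesis using False by (simp add: power2_eq_square mult_ac)
  qed
  \<comment> \<open>Squaring the sum doubles both bounds, giving \<open>4 * s\<close>, the factor 2
    at the tail and two copies of \<open>p / N\<close>; the term \<open>c / N\<close> gives
    \<open>1 / N\<close> and the third copy.\<close>
  have "c\<^sup>2 + c / N \<le> ?e"
  proof -
    have "c\<^sup>2 \<le> (s * z + p / N)\<^sup>2" using c szn by (intro power_mono) auto
    also have "\<dots> \<le> 2 * (s * z)\<^sup>2 + 2 * (p / N)\<^sup>2"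
    proof -
      have "(x + y)\<^sup>2 \<le> 2 * x\<^sup>2 + 2 * y\<^sup>2" for x y :: real
        using zero_le_power2 [of "x - y"] by (simp add: power2_eq_square algebra_simps)
      then show ?thesis .
    qed
    finally have c2: "c\<^sup>2 \<le> 2 * (s * z)\<^sup>2 + 2 * (p / N)\<^sup>2" .
    have pN2: "(p / N)\<^sup>2 \<le> p / N"
      using pN mult_right_mono [of "p / N" 1 "p / N"] by (simp add: power2_eq_square)
    have "c\<^sup>2 \<le> 2 * (2 * s * (s * z) + s * (if z \<ge> 2 then z else 0)) + 2 * (p / N)"
      using sz2 pN2 by (intro order_trans [OF c2] add_mono mult_left_mono) auto
    moreover have "c / N \<le> s * z / N + p / N / N"
      using c N_pos unfolding add_divide_distrib [symmetric] by (intro divide_right_mono) auto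
    moreover have "p / N / N \<le> p / N"
      using N_ge N_pos p_pos by (simp add: field_simps)
    moreover have "?e = 2 * (2 * s * (s * z) + s * (if z \<ge> 2 then z else 0)) + 2 * (p / N)
        + s * z / N + p / N"
      by (simp add: algebra_simps)
    ultimately show ?thesis by linarith
  qed
  then have D_ge': "c * d z - B * ?e \<le> ?D"
    using D_ge mult_left_mono [OF _ B_nonneg, of "c\<^sup>2 + c / N" ?e] by linarith
  have e: "p / N \<le> ?e" "s * (if z \<ge> 2 then z else 0) \<le> ?e"
  proof -
    have "0 \<le> (4 * s + 1 / N) * (s * z)" "0 \<le> s * (if z \<ge> 2 then z else 0)"
      using szn s_pos N_pos z by (auto intro!: mult_nonneg_nonneg)
    then show "p / N \<le> ?e" "s * (if z \<ge> 2 then z else 0) \<le> ?e" using pN by linarith+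
  qed
  have "c * d z \<le> (s * z) * d z + L * ?e"
  proof -
    have "c * d z \<le> (s * z + p / N) * d z" using c d_nonneg [OF z] by (intro mult_right_mono)
    moreover have "p / N * d z \<le> ?e * L"
      using e pN d_nonneg [OF z] d_le [OF z] L_nonneg by (intro mult_mono) auto
    ultimately show ?thesis by (simp add: algebra_simps)
  qed
  moreover have "(s * z) * d z \<le> c * d z" using c d_nonneg [OF z] by (intro mult_right_mono)
  moreover have "\<bar>s * z * d z - k * (s * f z)\<bar> \<le> C * ?e"
  proof -
    have "\<bar>s * z * d z - k * (s * f z)\<bar> = s * \<bar>z * d z - k * f z\<bar>"
      using s_pos abs_mult [of s "z * d z - k * f z"] by (simp add: algebra_simps)
    also have "\<dots> \<le> s * (if z \<ge> 2 then C * z else 0)"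
      using s_pos euler [OF z] by (intro mult_left_mono) auto
    also have "\<dots> = C * (s * (if z \<ge> 2 then z else 0))" by simp
    also have "\<dots> \<le> C * ?e" using e C_nonneg by (intro mult_left_mono)
    finally show ?thesis .
  qed
  moreover have "(L + B + C) * ?e = L * ?e + B * ?e + C * ?e" by (simp only: distrib_right)
  moreover have "0 \<le> L * ?e" "0 \<le> B * ?e"
    using L_nonneg B_nonneg e(1) pN by (auto intro!: mult_nonneg_nonneg)
  ultimately show ?thesis using D_le D_ge' by linarith
qed

text \<open>The new pile brings \<open>f 1 = 1\<close> up to \<open>L * dev lam\<close>, and the old
  piles lose according to \<open>pile_drop\<close>. The errors proportional to \<open>s * z\<close>
  sum up harmlessly because the total area is 1.\<close>

lemma drift:
  assumes lam: "lam \<in> partitions n"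
  shows "\<bar>pick_exp p q lam (\<lambda>ks. lin f (move lam ks)) - lin f lam - (1 - k * (s * lin f lam))\<bar>
    \<le> (L + B + C) * err lam"
proof -
  define X where "X = (\<Sum>h\<leftarrow>lam. bin_exp p (cand q h) (\<lambda>j. f (real h / N) - f (real (h - j) / N)))"
  define Y where "Y = pick_exp p q lam (\<lambda>ks. f (real (sum_list ks) / N))"
  have split: "pick_exp p q lam (\<lambda>ks. lin f (move lam ks)) - lin f lam = Y - X"
    unfolding lin_def X_def Y_def
    by (rule pick_exp_sum_list_move [where g = "\<lambda>h. f (real h / N)"]) (simp add: f0)
  have hn: "h \<le> n" if "h \<in> set lam" for h
    using lam member_le_sum_list [OF that] by (simp add: partitions_def)
  let ?e = "\<lambda>z. (4 * s + 1 / N) * (s * z) + 2 * (s * (if z \<ge> 2 then z else 0)) + 3 * (p / N)"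
  have "\<bar>X - k * (s * lin f lam)\<bar>
      = \<bar>\<Sum>h\<leftarrow>lam. bin_exp p (cand q h) (\<lambda>j. f (real h / N) - f (real (h - j) / N))
           - k * (s * f (real h / N))\<bar>"
    by (simp add: X_def lin_def sum_list_subtractf sum_list_const_mult)
  also have "\<dots> \<le> (\<Sum>h\<leftarrow>lam. \<bar>bin_exp p (cand q h) (\<lambda>j. f (real h / N) - f (real (h - j) / N))
           - k * (s * f (real h / N))\<bar>)"
    by (rule order_trans [OF sum_list_abs]) (simp add: comp_def)
  also have "\<dots> \<le> (\<Sum>h\<leftarrow>lam. (L + B + C) * ?e (real h / N))"
    by (intro sum_list_mono pile_drop hn)
  also have "\<dots> = (L + B + C) * ((4 * s + 1 / N) + 2 * tail lam + 3 * excess lam)"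
  proof -
    have "(\<Sum>h\<leftarrow>lam. ?e (real h / N)) = (4 * s + 1 / N) * 1 + 2 * tail lam + 3 * excess lam"
      unfolding sum_list_addf sum_list_const_mult tail_def sum_scaled_heights [OF lam]
        sum_scaled_heights [OF lam, unfolded sum_list_const_mult]
      by (simp add: sum_list_triv excess_def)
    then show ?thesis by (simp only: sum_list_const_mult mult_1_right)
  qed
  finally have X: "\<bar>X - k * (s * lin f lam)\<bar>
      \<le> (L + B + C) * ((4 * s + 1 / N) + 2 * tail lam + 3 * excess lam)" .
  have Zpos: "0 \<le> real (sum_list ks) / N" for ks using N_pos by simp
  have "Y \<le> pick_exp p q lam (\<lambda>ks. 1 + L * \<bar>real (sum_list ks) / N - 1\<bar>)"
    unfolding Y_def using lipschitz [OF Zpos, of 1] f1 p_pos p_le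
    by (intro pick_exp_mono) (auto simp: abs_le_iff algebra_simps)
  moreover have "pick_exp p q lam (\<lambda>ks. 1 - L * \<bar>real (sum_list ks) / N - 1\<bar>) \<le> Y"
    unfolding Y_def using lipschitz [OF Zpos, of 1] f1 p_pos p_le
    by (intro pick_exp_mono) (auto simp: abs_le_iff algebra_simps)
  ultimately have "\<bar>Y - 1\<bar> \<le> L * dev lam"
    by (simp add: pick_exp_add pick_exp_diff pick_exp_cmult dev_def abs_le_iff)
  moreover have "L * dev lam \<le> (L + B + C) * (2 * dev lam)"
    using L_nonneg B_nonneg C_nonneg dev_nonneg [of lam] by (intro mult_mono) auto
  moreover have "(L + B + C) * err lam
      = (L + B + C) * ((4 * s + 1 / N) + 2 * tail lam + 3 * excess lam) + (L + B + C) * (2 * dev lam)"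
    by (simp only: err_def distrib_left)
  ultimately show ?thesis unfolding split using X by linarith
qed

lemma lin_bounds:
  assumes "lam \<in> partitions n"
  shows "0 \<le> s * lin f lam" "s * lin f lam \<le> L"
proof -
  have z: "0 \<le> real h / N" for h :: nat using N_pos by simp
  show "0 \<le> s * lin f lam"
    unfolding lin_def using s_pos f_bounds(1) [OF z] by (intro mult_nonneg_nonneg sum_list_nonneg) auto
  have "s * lin f lam \<le> s * (\<Sum>h\<leftarrow>lam. L * (real h / N))"
    unfolding lin_def using s_pos f_bounds(2) [OF z] by (intro mult_left_mono sum_list_mono) auto
  also have "\<dots> = L * (\<Sum>h\<leftarrow>lam. s * (real h / N))"
    by (simp only: sum_list_const_mult mult_ac)
  finally show "s * lin f lam \<le> L" using sum_scaled_heights [OF assms] by simp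
qed

text \<open>The gain of the new pile and the loss of the old ones both lie between 0 and
  \<open>L\<close> times the height of the new pile, and they enter with opposite signs.\<close>

lemma move_change_le:
  assumes "ks \<in> picks q lam"
  shows "\<bar>lin f (move lam ks) - lin f lam\<bar> \<le> L * (real (sum_list ks) / N)"
proof -
  let ?drop = "sum_list (map2 (\<lambda>h j. f (real h / N) - f (real (h - j) / N)) lam ks)"
  have "lin f (move lam ks)
      = f (real (sum_list ks) / N) + sum_list (map2 (\<lambda>h j. f (real (h - j) / N)) lam ks)"
    unfolding lin_def by (rule sum_list_move) (simp add: f0)
  moreover have "sum_list (map2 (\<lambda>h j. f (real (h - j) / N)) lam ks) = lin f lam - ?drop
      \<and> 0 \<le> ?drop \<and> ?drop \<le> L * (real (sum_list ks) / N)"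
    using assms
  proof (induction lam arbitrary: ks)
    case (Cons h lam)
    then obtain j ks' where ks: "ks = j # ks'" and j: "j \<le> cand q h" and ks': "ks' \<in> picks q lam"
      by (auto simp: picks_Cons)
    have "j \<le> h" using j cand_le [OF q_le, of h] by simp
    then have "0 \<le> real (h - j) / N" "real (h - j) / N \<le> real h / N"
        "real h / N - real (h - j) / N = real j / N"
      using N_pos by (auto simp: of_nat_diff diff_divide_distrib divide_right_mono)
    then have "0 \<le> f (real h / N) - f (real (h - j) / N)"
        "f (real h / N) - f (real (h - j) / N) \<le> L * (real j / N)"
      using mono [of "real (h - j) / N" "real h / N"]
        lipschitz [of "real h / N" "real (h - j) / N"] N_pos by auto
    then show ?case using Cons.IH [OF ks']
      by (simp add: ks lin_def algebra_simps add_divide_distrib)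
  qed (simp add: lin_def)
  moreover have "0 \<le> f (real (sum_list ks) / N)" "f (real (sum_list ks) / N) \<le> L * (real (sum_list ks) / N)"
    using f_bounds [of "real (sum_list ks) / N"] N_pos by auto
  ultimately show ?thesis by (auto simp: abs_le_iff)
qed

text \<open>With \<open>M = s * lin f lam\<close>, the square is
  \<open>(1 - k * M) - k * M * (1 - k * M)\<close>. Stationarity of \<open>M\<close> makes the mean
  of the first term small; stationarity of its square does so for the second.\<close>

lemma second_moment:
  assumes k: "0 \<le> k"
  shows "expc (\<lambda>lam. (1 - k * (s * lin f lam))\<^sup>2)
    \<le> ((L + B + C) + k * L\<^sup>2 + k * L * (L + B + C)) * expc err"
proof -
  define D where "D = L + B + C"
  define M where "M lam = s * lin f lam" for lam
  define A where "A lam = pick_exp p q lam (\<lambda>ks. lin f (move lam ks)) - lin f lam" for lam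
  have D: "0 \<le> D" using L_nonneg B_nonneg C_nonneg by (simp add: D_def)
  have drift': "\<bar>A lam - (1 - k * M lam)\<bar> \<le> D * err lam" if "lam \<in> partitions n" for lam
    using drift [OF that] by (simp add: A_def M_def D_def)
  have "expc A = 0"
    unfolding A_def by (simp add: expc_diff expc_move [of "lin f"])
  moreover have "expc (\<lambda>lam. (1 - k * M lam) - A lam) \<le> expc (\<lambda>lam. D * err lam)"
    using drift' by (intro expc_mono) (auto simp: abs_le_iff)
  ultimately have first: "expc (\<lambda>lam. 1 - k * M lam) \<le> D * expc err"
    by (simp add: expc_diff [of _ A] expc_cmult)
  \<comment> \<open>Stationarity of the square of \<open>M\<close>; only the quadratic term of the increment needs a bound.\<close>
  define Q where "Q lam = pick_exp p q lam (\<lambda>ks. (M (move lam ks) - M lam)\<^sup>2)" for lam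
  have Q_le: "Q lam \<le> L\<^sup>2 * s * err lam" if lam: "lam \<in> partitions n" for lam
  proof -
    have "Q lam \<le> pick_exp p q lam (\<lambda>ks. L\<^sup>2 * s * (s + 2 * \<bar>real (sum_list ks) / N - 1\<bar>))"
      unfolding Q_def
    proof (rule pick_exp_mono)
      fix ks assume ks: "ks \<in> picks q lam"
      let ?Z = "real (sum_list ks) / N"
      have Z: "0 \<le> ?Z" using N_pos by simp
      have sZ: "s * ?Z \<le> 1"
        using sum_picks_le [OF lam ks] s_pos n_ge by (simp add: N_eq)
      have "(M (move lam ks) - M lam)\<^sup>2 = s\<^sup>2 * \<bar>lin f (move lam ks) - lin f lam\<bar>\<^sup>2"
        by (simp add: M_def power_mult_distrib flip: right_diff_distrib)
      also have "\<dots> \<le> s\<^sup>2 * (L * ?Z)\<^sup>2"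
        using move_change_le [OF ks] by (intro mult_left_mono power_mono) auto
      also have "\<dots> = L\<^sup>2 * s * ((s * ?Z) * ?Z)" by (simp add: power2_eq_square mult_ac)
      \<comment> \<open>One \<open>?Z\<close> is replaced by \<open>1 + \<bar>?Z - 1\<bar>\<close>,
        and \<open>s * ?Z \<le> 1\<close> is used on the deviation, so that only the first absolute
        moment of the deviation enters.\<close>
      also have "\<dots> \<le> L\<^sup>2 * s * (s + 2 * \<bar>?Z - 1\<bar>)"
      proof (intro mult_left_mono)
        have "(s * ?Z) * ?Z \<le> (s * ?Z) * (1 + \<bar>?Z - 1\<bar>)"
          using mult_nonneg_nonneg [OF _ Z, of s] s_pos by (intro mult_left_mono) auto
        also have "\<dots> = s * ?Z + (s * ?Z) * \<bar>?Z - 1\<bar>" by (simp only: distrib_left mult_1_right)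
        also have "\<dots> \<le> s * (1 + \<bar>?Z - 1\<bar>) + 1 * \<bar>?Z - 1\<bar>"
          using Z s_pos sZ by (intro add_mono mult_left_mono mult_right_mono) auto
        also have "\<dots> \<le> s + 2 * \<bar>?Z - 1\<bar>"
          using s_le mult_right_mono [OF s_le, of "\<bar>?Z - 1\<bar>"] by (simp add: algebra_simps)
        finally show "(s * ?Z) * ?Z \<le> s + 2 * \<bar>?Z - 1\<bar>" .
      qed (use s_pos in auto)
      finally show "(M (move lam ks) - M lam)\<^sup>2 \<le> L\<^sup>2 * s * (s + 2 * \<bar>?Z - 1\<bar>)" .
    qed (use p_pos p_le in auto)
    also have "\<dots> = L\<^sup>2 * s * (s + 2 * dev lam)"
      unfolding pick_exp_cmult pick_exp_add pick_exp_const dev_def ..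
    also have "\<dots> \<le> L\<^sup>2 * s * err lam"
      using s_pos N_pos tail_nonneg [of lam] excess_nonneg [of lam]
      by (intro mult_left_mono) (auto simp: err_def)
    finally show ?thesis .
  qed
  have "expc (\<lambda>lam. (M lam)\<^sup>2) = expc (\<lambda>lam. ((M lam)\<^sup>2 + (2 * s) * (M lam * A lam)) + Q lam)"
  proof (subst expc_move, rule expc_cong)
    fix lam
    have "pick_exp p q lam (\<lambda>ks. (M (move lam ks))\<^sup>2)
       = pick_exp p q lam (\<lambda>ks. ((M lam)\<^sup>2 + (2 * M lam * s) * (lin f (move lam ks) - lin f lam))
             + (M (move lam ks) - M lam)\<^sup>2)"
      by (intro pick_exp_cong) (simp add: M_def power2_eq_square algebra_simps)
    also have "\<dots> = ((M lam)\<^sup>2 + (2 * s) * (M lam * A lam)) + Q lam"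
      unfolding pick_exp_add pick_exp_cmult pick_exp_diff pick_exp_const Q_def A_def by simp
    finally show "pick_exp p q lam (\<lambda>ks. (M (move lam ks))\<^sup>2)
       = ((M lam)\<^sup>2 + (2 * s) * (M lam * A lam)) + Q lam" .
  qed
  then have "2 * s * expc (\<lambda>lam. M lam * A lam) + expc Q = 0"
    unfolding expc_add expc_cmult by simp
  moreover have "expc Q \<le> L\<^sup>2 * s * expc err"
    unfolding expc_cmult [symmetric] by (intro expc_mono Q_le)
  \<comment> \<open>The drift of the square carries a factor \<open>s\<close>, and so does the bound
    on \<open>Q\<close>; it cancels and leaves a bound of order \<open>expc err\<close>.\<close>
  ultimately have "s * (- 2 * expc (\<lambda>lam. M lam * A lam)) \<le> s * (L\<^sup>2 * expc err)"
    by (simp add: algebra_simps)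
  then have "- 2 * expc (\<lambda>lam. M lam * A lam) \<le> L\<^sup>2 * expc err"
    using s_pos by (simp only: mult_le_cancel_left_pos)
  moreover have "0 \<le> L\<^sup>2 * expc err"
    using expc_mono [of "\<lambda>_. 0" err] err_nonneg by simp
  ultimately have MA: "- expc (\<lambda>lam. M lam * A lam) \<le> L\<^sup>2 * expc err" by simp
  \<comment> \<open>Replacing the true drift \<open>A\<close> by \<open>1 - k * M\<close> costs at
    most \<open>L * D * err\<close>, since \<open>M\<close> lies between 0 and
    \<open>L\<close>.\<close>
  have "expc (\<lambda>lam. M lam * A lam - M lam * (1 - k * M lam)) \<le> expc (\<lambda>lam. L * D * err lam)"
  proof (rule expc_mono)
    fix lam assume lam: "lam \<in> partitions n"
    have "M lam * A lam - M lam * (1 - k * M lam) \<le> M lam * (D * err lam)"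
      unfolding right_diff_distrib [symmetric]
      using lin_bounds [OF lam] drift' [OF lam] by (intro mult_left_mono) (auto simp: M_def)
    also have "\<dots> \<le> L * (D * err lam)"
      using lin_bounds [OF lam] D err_nonneg by (intro mult_right_mono) (auto simp: M_def)
    finally show "M lam * A lam - M lam * (1 - k * M lam) \<le> L * D * err lam" by simp
  qed
  then have "- expc (\<lambda>lam. M lam * (1 - k * M lam)) \<le> L\<^sup>2 * expc err + L * D * expc err"
    using MA by (simp add: expc_diff expc_cmult)
  then have second: "k * (- expc (\<lambda>lam. M lam * (1 - k * M lam))) \<le> k * (L\<^sup>2 * expc err + L * D * expc err)"
    using k by (intro mult_left_mono)
  have "expc (\<lambda>lam. (1 - k * M lam)\<^sup>2)
      = expc (\<lambda>lam. (1 - k * M lam) - k * (M lam * (1 - k * M lam)))"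
    by (intro expc_cong) (simp add: power2_eq_square algebra_simps)
  also have "\<dots> = expc (\<lambda>lam. 1 - k * M lam) + k * (- expc (\<lambda>lam. M lam * (1 - k * M lam)))"
    by (simp only: expc_diff [of "\<lambda>lam. 1 - k * M lam"] expc_cmult)
  also have "\<dots> \<le> D * expc err + k * (L\<^sup>2 * expc err + L * D * expc err)"
    using first second by (rule add_mono)
  also have "\<dots> = (D + k * L\<^sup>2 + k * L * D) * expc err" by (simp add: algebra_simps)
  finally show ?thesis by (simp add: D_def M_def)
qed

end

section \<open>From moments to continuous test functions\<close>

lemma moment_bound:
  assumes "1 \<le> N" "1 \<le> k"
  shows "expc (\<lambda>lam. (1 - real k * (s * lin (lin_pow k) lam))\<^sup>2) \<le> moment_const k * expc err"
proof -
  note L = lin_pow_0 [OF assms(2)] lin_pow_1 [OF assms(2)] lin_pow_mono [OF assms(2)]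
    lin_pow_upper [OF assms(2)] lin_pow_lower [OF assms(2)] lin_pow_deriv_bounds [OF assms(2)]
    lin_pow_euler [OF assms(2)]
  show ?thesis unfolding moment_const_def Let_def
    by (rule second_moment [OF assms(1) L]) auto
qed

text \<open>The Cauchy-Schwarz inequality for a probability measure: the variance of
  \<open>\<bar>F\<bar>\<close> is nonnegative.\<close>

lemma expc_abs_le_sqrt: "expc (\<lambda>lam. \<bar>F lam\<bar>) \<le> sqrt (expc (\<lambda>lam. (F lam)\<^sup>2))"
proof (rule real_le_rsqrt)
  let ?m = "expc (\<lambda>lam. \<bar>F lam\<bar>)"
  have "0 \<le> expc (\<lambda>lam. (\<bar>F lam\<bar> - ?m)\<^sup>2)"
    using expc_mono [of "\<lambda>_. 0"] by simp
  also have "\<dots> = expc (\<lambda>lam. ((F lam)\<^sup>2 - (2 * ?m) * \<bar>F lam\<bar>) + ?m\<^sup>2)"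
    by (intro expc_cong) (simp add: power2_diff algebra_simps)
  also have "\<dots> = expc (\<lambda>lam. (F lam)\<^sup>2) - ?m\<^sup>2"
    unfolding expc_add expc_diff expc_cmult expc_const by (simp add: power2_eq_square)
  finally show "?m\<^sup>2 \<le> expc (\<lambda>lam. (F lam)\<^sup>2)" by simp
qed

lemma expc_sum: "expc (\<lambda>lam. \<Sum>i\<in>A. F i lam) = (\<Sum>i\<in>A. expc (F i))"
  unfolding expc_def sum_distrib_left by (rule sum.swap)

text \<open>An error of \<open>\<delta> * z\<close> sums to at most \<open>\<delta>\<close> because
  the area is 1; the cruder linear error at high piles is charged to \<open>tail\<close>.\<close>

lemma lin_approx:
  assumes lam: "lam \<in> partitions n"
    and near: "\<And>z. 0 \<le> z \<Longrightarrow> z < 2 \<Longrightarrow> \<bar>F z - G z\<bar> \<le> \<delta> * z"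
    and far: "\<And>z. 2 \<le> z \<Longrightarrow> \<bar>F z - G z\<bar> \<le> D * z"
    and nonneg: "0 \<le> \<delta>" "0 \<le> D"
  shows "\<bar>s * lin F lam - s * lin G lam\<bar> \<le> \<delta> + D * tail lam"
proof -
  have "\<bar>s * lin F lam - s * lin G lam\<bar> = s * \<bar>\<Sum>h\<leftarrow>lam. F (real h / N) - G (real h / N)\<bar>"
    using s_pos by (simp add: lin_def sum_list_subtractf abs_mult flip: right_diff_distrib)
  also have "\<dots> \<le> s * (\<Sum>h\<leftarrow>lam. \<bar>F (real h / N) - G (real h / N)\<bar>)"
    using s_pos sum_list_abs [of "map (\<lambda>h. F (real h / N) - G (real h / N)) lam"]
    by (intro mult_left_mono) (auto simp: comp_def)
  also have "\<dots> \<le> s * (\<Sum>h\<leftarrow>lam. \<delta> * (real h / N) + D * (if real h / N \<ge> 2 then real h / N else 0))"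
  proof (intro mult_left_mono sum_list_mono)
    fix h :: nat
    let ?z = "real h / N"
    have "0 \<le> \<delta> * ?z" using nonneg N_pos by simp
    then show "\<bar>F ?z - G ?z\<bar> \<le> \<delta> * ?z + D * (if ?z \<ge> 2 then ?z else 0)"
      using near [of ?z] far [of ?z] N_pos by (cases "2 \<le> ?z") auto
  qed (use s_pos in auto)
  also have "\<dots> = \<delta> * (\<Sum>h\<leftarrow>lam. s * (real h / N)) + D * tail lam"
    unfolding sum_list_addf sum_list_const_mult tail_def by (simp only: distrib_left mult_ac)
  finally show ?thesis by (simp only: sum_scaled_heights [OF lam] mult_1_right)
qed

text \<open>The factor \<open>z\<close> turns \<open>z ^ i\<close> into the moment of order
  \<open>i + 1\<close>, which is close to \<open>1 / (i + 1)\<close>, the integral of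
  \<open>z ^ i\<close> over the unit interval. One \<open>\<delta>\<close> is spent on approximating
  \<open>W\<close>, the other on approximating \<open>I\<close>.\<close>

lemma polynomial_approx:
  fixes a :: "nat \<Rightarrow> real"
  assumes N: "1 \<le> N" and \<delta>: "0 \<le> \<delta>"
    and W: "\<And>z. 0 \<le> z \<Longrightarrow> z \<le> 2 \<Longrightarrow> \<bar>W z - (\<Sum>i\<le>m. a i * z ^ i)\<bar> \<le> \<delta>"
    and W_far: "\<And>z. 2 \<le> z \<Longrightarrow> \<bar>W z\<bar> \<le> 1"
    and I: "\<bar>(\<Sum>i\<le>m. a i / (real i + 1)) - I\<bar> \<le> \<delta>"
  shows "expc (\<lambda>lam. \<bar>s * lin (\<lambda>z. z * W z) lam - I\<bar>)
    \<le> 2 * \<delta> + (\<Sum>i\<le>m. \<bar>a i\<bar> * sqrt (moment_const (Suc i) * expc err))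
       + (1 + (\<Sum>i\<le>m. \<bar>a i\<bar> * (real (Suc i) * 2 ^ i))) * expc err"
proof -
  \<comment> \<open>The growth rate of the error above height 2: 1 for \<open>W\<close>, and the
    largest slopes of the continued powers for the polynomial.\<close>
  define D where "D = 1 + (\<Sum>i\<le>m. \<bar>a i\<bar> * (real (Suc i) * 2 ^ i))"
  define G where "G z = (\<Sum>i\<le>m. a i * lin_pow (Suc i) z)" for z
  define X where "X i lam = 1 - real (Suc i) * (s * lin (lin_pow (Suc i)) lam)" for i lam
  have D: "0 \<le> D" unfolding D_def by (intro add_nonneg_nonneg sum_nonneg) auto
  have near: "\<bar>z * W z - G z\<bar> \<le> \<delta> * z" if "0 \<le> z" "z < 2" for z
  proof -
    have "z * W z - G z = z * (W z - (\<Sum>i\<le>m. a i * z ^ i))"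
      using that by (simp add: G_def lin_pow_def sum_distrib_left algebra_simps)
    then have "\<bar>z * W z - G z\<bar> = z * \<bar>W z - (\<Sum>i\<le>m. a i * z ^ i)\<bar>"
      using that by (simp add: abs_mult)
    also have "\<dots> \<le> z * \<delta>" using that W by (intro mult_left_mono) auto
    finally show ?thesis by (simp add: mult.commute)
  qed
  have far: "\<bar>z * W z - G z\<bar> \<le> D * z" if z: "2 \<le> z" for z
  proof -
    have "\<bar>z * W z\<bar> \<le> z * 1"
      unfolding abs_mult using z W_far [OF z] by (intro mult_mono) auto
    moreover have "\<bar>G z\<bar> \<le> (\<Sum>i\<le>m. \<bar>a i\<bar> * (real (Suc i) * 2 ^ i)) * z"
      unfolding G_def sum_distrib_right
    proof (rule order_trans [OF sum_abs], rule sum_mono)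
      fix i
      have "0 \<le> lin_pow (Suc i) z"
        using lin_pow_mono [of "Suc i" 0 z] lin_pow_0 [of "Suc i"] z by simp
      moreover have "lin_pow (Suc i) z \<le> z * (real (Suc i) * 2 ^ i)"
      proof -
        have "z * lin_pow_deriv (Suc i) z \<le> z * (real (Suc i) * 2 ^ i)"
          using lin_pow_deriv_bounds(2) [of "Suc i" z] z by (intro mult_left_mono) auto
        moreover have "lin_pow (Suc i) z \<le> z * lin_pow_deriv (Suc i) z"
          using lin_pow_upper [of "Suc i" 0 z] lin_pow_0 [of "Suc i"] z by simp
        ultimately show ?thesis by (rule order_trans [rotated])
      qed
      ultimately have "\<bar>a i\<bar> * \<bar>lin_pow (Suc i) z\<bar> \<le> \<bar>a i\<bar> * (z * (real (Suc i) * 2 ^ i))"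
        by (intro mult_left_mono) auto
      then show "\<bar>a i * lin_pow (Suc i) z\<bar> \<le> \<bar>a i\<bar> * (real (Suc i) * 2 ^ i) * z"
        by (simp add: abs_mult mult_ac)
    qed
    ultimately show ?thesis unfolding D_def distrib_right by linarith
  qed
  have pointwise: "\<bar>s * lin (\<lambda>z. z * W z) lam - I\<bar> \<le> (2 * \<delta> + D * err lam) + (\<Sum>i\<le>m. \<bar>a i\<bar> * \<bar>X i lam\<bar>)"
    if lam: "lam \<in> partitions n" for lam
  proof -
    have "tail lam \<le> err lam"
      using s_pos N_pos tail_nonneg [of lam] excess_nonneg [of lam] dev_nonneg [of lam]
      by (simp add: err_def add_increasing)
    then have "D * tail lam \<le> D * err lam" using D by (rule mult_left_mono)
    moreover have "\<bar>s * lin (\<lambda>z. z * W z) lam - s * lin G lam\<bar> \<le> \<delta> + D * tail lam"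
      using lin_approx [OF lam near far \<delta> D] by simp
    moreover have "\<bar>s * lin G lam - (\<Sum>i\<le>m. a i / (real i + 1))\<bar> \<le> (\<Sum>i\<le>m. \<bar>a i\<bar> * \<bar>X i lam\<bar>)"
    proof -
      have "lin G lam = (\<Sum>i\<le>m. a i * lin (lin_pow (Suc i)) lam)"
        unfolding lin_def G_def
        by (induction lam) (simp_all add: sum.distrib distrib_left)
      then have "s * lin G lam - (\<Sum>i\<le>m. a i / (real i + 1))
          = (\<Sum>i\<le>m. - (a i / (real i + 1)) * X i lam)"
        by (simp add: sum_distrib_left X_def flip: sum_subtractf)
           (intro sum.cong refl, simp add: field_simps)
      also have "\<bar>\<dots>\<bar> \<le> (\<Sum>i\<le>m. \<bar>- (a i / (real i + 1)) * X i lam\<bar>)" by (rule sum_abs)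
      also have "\<dots> \<le> (\<Sum>i\<le>m. \<bar>a i\<bar> * \<bar>X i lam\<bar>)"
        unfolding abs_mult
      proof (intro sum_mono mult_right_mono)
        fix i
        have "\<bar>a i\<bar> * 1 \<le> \<bar>a i\<bar> * (real i + 1)" by (intro mult_left_mono) auto
        then show "\<bar>- (a i / (real i + 1))\<bar> \<le> \<bar>a i\<bar>" by (simp add: field_simps)
      qed auto
      finally show ?thesis .
    qed
    ultimately show ?thesis using I by linarith
  qed
  have "expc (\<lambda>lam. \<bar>s * lin (\<lambda>z. z * W z) lam - I\<bar>)
     \<le> expc (\<lambda>lam. (2 * \<delta> + D * err lam) + (\<Sum>i\<le>m. \<bar>a i\<bar> * \<bar>X i lam\<bar>))"
    by (intro expc_mono pointwise)
  also have "\<dots> = 2 * \<delta> + D * expc err + (\<Sum>i\<le>m. \<bar>a i\<bar> * expc (\<lambda>lam. \<bar>X i lam\<bar>))"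
    unfolding expc_add expc_sum expc_cmult expc_const ..
  also have "\<dots> \<le> 2 * \<delta> + D * expc err + (\<Sum>i\<le>m. \<bar>a i\<bar> * sqrt (moment_const (Suc i) * expc err))"
  proof (intro add_left_mono sum_mono mult_left_mono)
    fix i
    have "expc (\<lambda>lam. \<bar>X i lam\<bar>) \<le> sqrt (expc (\<lambda>lam. (X i lam)\<^sup>2))"
      by (rule expc_abs_le_sqrt)
    also have "\<dots> \<le> sqrt (moment_const (Suc i) * expc err)"
      using moment_bound [OF N, of "Suc i"] by (simp only: real_sqrt_le_iff X_def)
    finally show "expc (\<lambda>lam. \<bar>X i lam\<bar>) \<le> sqrt (moment_const (Suc i) * expc err)" .
  qed auto
  finally show ?thesis by (simp add: D_def)
qed

text \<open>The factor 10 collects 2 from \<open>dev\<close> and 8 from \<open>2 * tail\<close>, by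
  \<open>expc_tail_le\<close>.\<close>

lemma expc_err_le:
  defines "\<rho> \<equiv> (1 + ln (real n)) / (p * q\<^sup>2 * real n)"
  shows "expc err \<le> 4 * s + 1 / N + 3 * \<rho> + 10 * (\<rho> + (1 + \<rho>) / sqrt N)"
proof -
  have \<rho>: "expc excess \<le> \<rho>" unfolding \<rho>_def by (rule expc_excess_le)
  have "expc dev \<le> expc (\<lambda>lam. excess lam + (1 / sqrt N) * (1 + excess lam))"
    using dev_le by (intro expc_mono) auto
  also have "\<dots> = expc excess + (1 / sqrt N) * (1 + expc excess)"
    unfolding expc_add expc_cmult expc_const ..
  also have "\<dots> \<le> \<rho> + (1 / sqrt N) * (1 + \<rho>)"
    using \<rho> N_pos by (intro add_mono mult_left_mono) auto
  finally have dev: "expc dev \<le> \<rho> + (1 + \<rho>) / sqrt N" by simp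
  have "expc err = (4 * s + 1 / N) + 2 * expc tail + 3 * expc excess + 2 * expc dev"
    unfolding err_def expc_add expc_cmult expc_const ..
  moreover define y where "y = \<rho> + (1 + \<rho>) / sqrt N"
  ultimately show ?thesis using dev \<rho> expc_tail_le unfolding y_def [symmetric] by linarith
qed

section \<open>From pile counts to the shape\<close>

lemma rho_scaled: "rho (1 / (p * q)) n lam x = real (Defs.part lam (Suc (nat \<lfloor>x / s\<rfloor>))) / N"
  by (simp add: rho_def N_def s_def)

text \<open>Counting piles by height inverts the boundary function. If part number
  \<open>\<lfloor>x / s\<rfloor> + 1\<close> reaches \<open>y\<close>, at least that many piles do,
  and this number exceeds \<open>x / s\<close>.\<close>

lemma le_rho_imp:
  assumes "lam \<in> partitions n" "0 < x" "0 < y" "y \<le> rho (1 / (p * q)) n lam x"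
  shows "x < s * (\<Sum>h\<leftarrow>lam. if y \<le> real h / N then 1 else 0)"
proof -
  have "nat \<lfloor>x / s\<rfloor> < length (filter (\<lambda>h. y * N \<le> real h) lam)"
    using assms N_pos unfolding rho_scaled
    by (intro length_filter_gt_of_part_ge) (auto simp: partitions_def pos_le_divide_eq)
  then have "x / s < real (length (filter (\<lambda>h. y * N \<le> real h) lam))"
    using assms(2) s_pos by linarith
  then show ?thesis
    using s_pos N_pos by (simp add: sum_list_indicator pos_le_divide_eq pos_divide_less_eq mult.commute)
qed

lemma rho_less_imp:
  assumes "lam \<in> partitions n" "0 < x" "0 < y" "rho (1 / (p * q)) n lam x < y"
  shows "s * (\<Sum>h\<leftarrow>lam. if y \<le> real h / N then 1 else 0) \<le> x"
proof -
  have "length (filter (\<lambda>h. y * N \<le> real h) lam) \<le> nat \<lfloor>x / s\<rfloor>"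
    using assms N_pos unfolding rho_scaled
    by (intro length_filter_le_of_part_less) (auto simp: partitions_def pos_divide_less_eq)
  moreover have "real (nat \<lfloor>x / s\<rfloor>) \<le> x / s"
    using assms(2) s_pos by simp
  ultimately have "real (length (filter (\<lambda>h. y * N \<le> real h) lam)) \<le> x / s"
    by linarith
  then show ?thesis
    using s_pos N_pos by (simp add: sum_list_indicator pos_le_divide_eq mult.commute)
qed

lemma lin_ramp_bounds:
  assumes "0 < b" "b < a"
  shows "s * lin (\<lambda>z. z * ramp b a z) lam \<le> s * (\<Sum>h\<leftarrow>lam. if b \<le> real h / N then 1 else 0)"
    and "s * (\<Sum>h\<leftarrow>lam. if a \<le> real h / N then 1 else 0) \<le> s * lin (\<lambda>z. z * ramp b a z) lam"
proof -
  have z: "0 \<le> real h / N" for h :: nat using N_pos by simp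
  show "s * lin (\<lambda>z. z * ramp b a z) lam \<le> s * (\<Sum>h\<leftarrow>lam. if b \<le> real h / N then 1 else 0)"
    unfolding lin_def using s_pos by (intro mult_left_mono sum_list_mono ramp_bounds [OF assms z]) auto
  show "s * (\<Sum>h\<leftarrow>lam. if a \<le> real h / N then 1 else 0) \<le> s * lin (\<lambda>z. z * ramp b a z) lam"
    unfolding lin_def using s_pos by (intro mult_left_mono sum_list_mono ramp_bounds [OF assms z]) auto
qed

lemma markov:
  assumes "0 < \<eta>" "A \<subseteq> partitions n" "\<And>lam. lam \<in> A \<Longrightarrow> \<eta> \<le> F lam"
    and "\<And>lam. lam \<in> partitions n \<Longrightarrow> 0 \<le> F lam"
  shows "(\<Sum>lam\<in>A. \<pi> lam) \<le> expc F / \<eta>"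
proof -
  have "(\<Sum>lam\<in>A. \<pi> lam * \<eta>) \<le> (\<Sum>lam\<in>A. \<pi> lam * F lam)"
    using assms by (intro sum_mono mult_left_mono \<pi>_nonneg) auto
  also have "\<dots> \<le> expc F"
    unfolding expc_def using assms \<pi>_nonneg by (intro sum_mono2) auto
  finally show ?thesis using assms(1) by (simp add: pos_le_divide_eq sum_distrib_right)
qed

definition ramp_error :: "real \<Rightarrow> real \<Rightarrow> nat list \<Rightarrow> real" where
  "ramp_error b a lam = \<bar>s * lin (\<lambda>z. z * ramp b a z) lam - integral {0..1} (ramp b a)\<bar>"

text \<open>If the boundary at \<open>x\<close> is too high, the scaled count of piles above
  \<open>exp (- x) + \<epsilon>\<close> exceeds \<open>x\<close>, and with it the ramp sum, although
  its limit is at most \<open>x - \<eta>\<close>; too low a boundary is symmetric, with limit at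
  least \<open>x + \<eta>\<close>. Either way a ramp error reaches \<open>\<eta>\<close>, and
  Markov's inequality applies.\<close>

lemma shape_deviation:
  assumes x: "0 < x" and \<epsilon>: "0 < \<epsilon>" and \<eta>: "0 < \<eta>"
    and hi: "0 < b\<^sub>1" "b\<^sub>1 < exp (- x) + \<epsilon>" "max 0 (- ln b\<^sub>1) + \<eta> \<le> x"
    and lo: "0 < b\<^sub>2" "exp (- x) - \<epsilon> < b\<^sub>2" "b\<^sub>2 < a" "a \<le> 1" "x + \<eta> \<le> - ln a"
  shows "1 - (\<Sum>lam\<in>{lam\<in>partitions n. \<bar>rho (1 / (p * q)) n lam x - exp (- x)\<bar> < \<epsilon>}. \<pi> lam)
    \<le> (expc (ramp_error b\<^sub>1 (exp (- x) + \<epsilon>)) + expc (ramp_error b\<^sub>2 a)) / \<eta>"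
proof -
  define good where "good = {lam\<in>partitions n. \<bar>rho (1 / (p * q)) n lam x - exp (- x)\<bar> < \<epsilon>}"
  let ?F = "\<lambda>lam. ramp_error b\<^sub>1 (exp (- x) + \<epsilon>) lam + ramp_error b\<^sub>2 a lam"
  have "(\<Sum>lam\<in>partitions n - good. \<pi> lam) \<le> expc ?F / \<eta>"
  proof (rule markov [OF \<eta>])
    fix lam assume "lam \<in> partitions n - good"
    then have lam: "lam \<in> partitions n" and
      "exp (- x) + \<epsilon> \<le> rho (1 / (p * q)) n lam x \<or> rho (1 / (p * q)) n lam x < b\<^sub>2"
      using lo by (auto simp: good_def)
    then consider "exp (- x) + \<epsilon> \<le> rho (1 / (p * q)) n lam x" | "rho (1 / (p * q)) n lam x < b\<^sub>2"
      by blast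
    then show "\<eta> \<le> ?F lam"
    proof cases
      case 1
      then have "x < s * lin (\<lambda>z. z * ramp b\<^sub>1 (exp (- x) + \<epsilon>) z) lam"
        using le_rho_imp [OF lam x _ 1] lin_ramp_bounds(2) [OF hi(1,2), of lam] \<epsilon>
        by (smt (verit) exp_gt_zero)
      then have "\<eta> \<le> ramp_error b\<^sub>1 (exp (- x) + \<epsilon>) lam"
        using integral_ramp_le [OF hi(1,2)] hi(3) unfolding ramp_error_def by linarith
      then show ?thesis unfolding ramp_error_def by linarith
    next
      case 2
      then have "s * lin (\<lambda>z. z * ramp b\<^sub>2 a z) lam \<le> x"
        using rho_less_imp [OF lam x lo(1) 2] lin_ramp_bounds(1) [OF lo(1,3), of lam] by linarith
      then have "\<eta> \<le> ramp_error b\<^sub>2 a lam"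
        using integral_ramp_ge [OF lo(1,3,4)] lo(5) unfolding ramp_error_def by linarith
      then show ?thesis unfolding ramp_error_def by linarith
    qed
  qed (auto simp: ramp_error_def)
  moreover have "(\<Sum>lam\<in>partitions n - good. \<pi> lam) = 1 - (\<Sum>lam\<in>good. \<pi> lam)"
    by (subst sum_diff) (auto simp: good_def \<pi>_total)
  ultimately show ?thesis by (simp add: good_def expc_add)
qed

end

section \<open>Asymptotics\<close>

locale solitaire_sequence =
  fixes p q :: "nat \<Rightarrow> real" and \<pi> :: "nat \<Rightarrow> nat list \<Rightarrow> real"
  assumes pq: "\<forall>n\<ge>1. 0 < p n \<and> p n \<le> 1 \<and> 0 < q n \<and> q n \<le> 1"
    and stat: "\<forall>n\<ge>1. stationary (p n) (q n) n (\<pi> n)"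
    and s_lim: "(\<lambda>n. p n * q n) \<longlonglongrightarrow> 0"
    and r_lim: "filterlim (\<lambda>n. p n * (q n)^2 * real n / ln (real n)) at_top sequentially"
begin

lemma solitaire: "1 \<le> n \<Longrightarrow> stationary_solitaire (p n) (q n) n (\<pi> n)"
  using pq stat by unfold_locales auto

definition r :: "nat \<Rightarrow> real" where
  "r n = p n * (q n)^2 * real n / ln (real n)"

text \<open>The single growth hypothesis controls two quantities: the first bound makes
  \<open>excess\<close> small, the second, by \<open>q n \<le> 1\<close>, makes \<open>N\<close>
  large. From \<open>n = 3\<close> on the logarithm is at least 1.\<close>

lemma r_le:
  assumes "3 \<le> n" "0 < r n"
  shows "r n \<le> p n * (q n)\<^sup>2 * real n" "r n \<le> p n * q n * real n"
proof -
  have ln: "1 \<le> ln (real n)"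
  proof -
    have "exp 1 \<le> real n" using exp_le assms by simp
    then show ?thesis using assms by (simp add: ln_ge_iff)
  qed
  have "r n * 1 \<le> r n * ln (real n)" using assms ln by (intro mult_left_mono) auto
  also have "\<dots> = p n * (q n)\<^sup>2 * real n" using ln by (simp add: r_def)
  finally show 1: "r n \<le> p n * (q n)\<^sup>2 * real n" by simp
  have "0 < p n" "0 < q n" "q n \<le> 1" using pq assms(1) by auto
  then have "p n * (q n * q n) * real n \<le> p n * (q n * 1) * real n"
    by (intro mult_right_mono mult_left_mono) auto
  then show "r n \<le> p n * q n * real n" using 1 by (simp add: power2_eq_square)
qed

lemma eventually_N_ge: "\<forall>\<^sub>F n in sequentially. 1 \<le> n \<and> 1 \<le> stationary_solitaire.N (p n) (q n) n"
proof -
  have "\<forall>\<^sub>F n in sequentially. 1 \<le> r n"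
    using r_lim unfolding r_def filterlim_at_top by blast
  then show ?thesis using eventually_ge_at_top [of 3]
  proof eventually_elim
    case (elim n)
    then interpret stationary_solitaire "p n" "q n" n "\<pi> n" by (intro solitaire) simp
    show ?case using r_le(2) [of n] elim by (simp add: N_def)
  qed
qed

definition mean_err :: "nat \<Rightarrow> real" where
  "mean_err n = stationary_solitaire.expc n (\<pi> n) (stationary_solitaire.err (p n) (q n) n)"

lemma mean_err_lim: "mean_err \<longlonglongrightarrow> 0"
proof -
  define u where "u n = 1 / r n" for n
  have u_lim: "u \<longlonglongrightarrow> 0"
    unfolding u_def r_def by (rule tendsto_divide_0 [OF tendsto_const filterlim_at_top_imp_at_infinity [OF r_lim]])
  \<comment> \<open>The bound of \<open>expc_err_le\<close> with \<open>1 / N\<close> replaced by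
    \<open>u n\<close> and \<open>\<rho>\<close> by \<open>2 * u n\<close>, one \<open>u n\<close>
    for each summand of \<open>1 + ln n\<close>.\<close>
  define U where "U n = 4 * (p n * q n) + u n + 3 * (2 * u n) + 10 * (2 * u n + (1 + 2 * u n) * sqrt (u n))" for n
  have "U \<longlonglongrightarrow> 4 * 0 + 0 + 3 * (2 * 0) + 10 * (2 * 0 + (1 + 2 * 0) * sqrt 0)"
    unfolding U_def by (intro tendsto_intros s_lim u_lim)
  then have U_lim: "U \<longlonglongrightarrow> 0" by simp
  have "\<forall>\<^sub>F n in sequentially. 1 \<le> r n"
    using r_lim unfolding r_def filterlim_at_top by blast
  then have "\<forall>\<^sub>F n in sequentially. 0 \<le> mean_err n \<and> mean_err n \<le> U n"
    using eventually_ge_at_top [of 3]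
  proof eventually_elim
    case (elim n)
    then interpret stationary_solitaire "p n" "q n" n "\<pi> n" by (intro solitaire) simp
    have r: "0 < r n" using elim by simp
    define \<rho> where "\<rho> = (1 + ln (real n)) / (p n * (q n)\<^sup>2 * real n)"
    have "1 / (p n * (q n)\<^sup>2 * real n) \<le> u n"
      unfolding u_def using r_le(1) [of n] elim by (intro divide_left_mono) auto
    moreover have "ln (real n) / (p n * (q n)\<^sup>2 * real n) = u n"
      by (simp add: u_def r_def)
    ultimately have \<rho>: "\<rho> \<le> 2 * u n" by (simp add: \<rho>_def add_divide_distrib)
    have "r n \<le> N" using r_le(2) [of n] elim by (simp add: N_def)
    then have N1: "1 / N \<le> u n" unfolding u_def using r by (intro divide_left_mono) auto
    then have N2: "1 / sqrt N \<le> sqrt (u n)"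
      using real_sqrt_le_mono [OF N1] by (simp add: real_sqrt_divide)
    have "0 \<le> \<rho>" using p_pos n_ge by (simp add: \<rho>_def)
    then have "(1 + \<rho>) * (1 / sqrt N) \<le> (1 + 2 * u n) * sqrt (u n)"
      using \<rho> N2 N_pos by (intro mult_mono) auto
    then have "\<rho> + (1 + \<rho>) / sqrt N \<le> 2 * u n + (1 + 2 * u n) * sqrt (u n)"
      using \<rho> by simp
    moreover have "mean_err n \<le> 4 * (p n * q n) + 1 / N + 3 * \<rho> + 10 * (\<rho> + (1 + \<rho>) / sqrt N)"
      using expc_err_le unfolding mean_err_def \<rho>_def [symmetric] s_def .
    moreover have "m \<le> c + A' + 3 * R' + 10 * Y'"
      if "Y \<le> Y'" "m \<le> c + A + 3 * R + 10 * Y" "R \<le> R'" "A \<le> A'" for m c A A' R R' Y Y' :: real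
      using that by linarith
    ultimately have "mean_err n \<le> U n"
      unfolding U_def using \<rho> N1 by blast
    moreover have "0 \<le> mean_err n"
      unfolding mean_err_def using expc_mono [of "\<lambda>_. 0" err] err_nonneg by simp
    ultimately show ?case by simp
  qed
  then have "\<forall>\<^sub>F n in sequentially. 0 \<le> mean_err n" "\<forall>\<^sub>F n in sequentially. mean_err n \<le> U n"
    by (auto elim: eventually_mono)
  then show ?thesis by (rule tendsto_sandwich [OF _ _ tendsto_const U_lim])
qed

definition mean_ramp_error :: "real \<Rightarrow> real \<Rightarrow> nat \<Rightarrow> real" where
  "mean_ramp_error b a n
     = stationary_solitaire.expc n (\<pi> n) (stationary_solitaire.ramp_error (p n) (q n) n b a)"

text \<open>The approximating polynomial is fixed before \<open>n\<close> grows, so its coefficients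
  and the moment constants are constant factors of quantities tending to 0.\<close>

lemma mean_ramp_error_lim:
  assumes ba: "0 < b" "b < a"
  shows "mean_ramp_error b a \<longlonglongrightarrow> 0"
proof (rule tendstoI)
  fix e :: real assume e: "0 < e"
  \<comment> \<open>\<open>polynomial_approx\<close> leaves \<open>2 * \<delta>\<close>, half of
    \<open>e\<close>; the other half absorbs the vanishing terms.\<close>
  define \<delta> where "\<delta> = e / 4"
  have \<delta>: "0 < \<delta>" using e by (simp add: \<delta>_def)
  define I where "I = integral {0..1} (ramp b a)"
  obtain g where g: "real_polynomial_function g" "\<And>z. z \<in> {0..2} \<Longrightarrow> \<bar>ramp b a z - g z\<bar> < \<delta>"
    using Stone_Weierstrass_real_polynomial_function [OF compact_Icc continuous_on_ramp [OF ba] \<delta>]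
    by blast
  then obtain c m where gc: "g = (\<lambda>z. \<Sum>i\<le>m. c i * z ^ i)"
    by (auto simp: real_polynomial_function_iff_sum)
  \<comment> \<open>The uniform approximation on \<open>[0, 2]\<close> also holds on the unit
    interval, so the two integrals differ by at most \<open>\<delta>\<close>.\<close>
  have "\<bar>(\<Sum>i\<le>m. c i / (real i + 1)) - I\<bar> \<le> \<delta>"
  proof -
    have "((\<lambda>z. z ^ i) has_integral 1 / (real i + 1)) {0..1::real}" for i
    proof -
      have "((\<lambda>z. z ^ i) has_integral 1 ^ Suc i / real (Suc i) - 0 ^ Suc i / real (Suc i)) {0..1::real}"
      proof (rule fundamental_theorem_of_calculus)
        fix z :: real
        have "((\<lambda>z. z ^ Suc i / real (Suc i)) has_real_derivative z ^ i) (at z within {0..1})"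
          by (rule derivative_eq_intros | simp)+
        then show "((\<lambda>z. z ^ Suc i / real (Suc i)) has_vector_derivative z ^ i) (at z within {0..1})"
          by (simp only: has_real_derivative_iff_has_vector_derivative)
      qed simp
      then show ?thesis by (simp add: add.commute)
    qed
    then have "(g has_integral (\<Sum>i\<le>m. c i * (1 / (real i + 1)))) {0..1}"
      unfolding gc by (intro has_integral_sum has_integral_mult_right) auto
    then have G: "(g has_integral (\<Sum>i\<le>m. c i / (real i + 1))) {0..1}" by simp
    have W: "(ramp b a has_integral I) {0..1}"
      unfolding I_def by (intro integrable_integral integrable_continuous_interval continuous_on_ramp ba)
    have "((\<lambda>z. g z - ramp b a z) has_integral (\<Sum>i\<le>m. c i / (real i + 1)) - I) {0..1}"
      by (rule has_integral_diff [OF G W])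
    then have "norm ((\<Sum>i\<le>m. c i / (real i + 1)) - I) \<le> \<delta> * content (cbox 0 (1::real))"
      using \<delta> g(2) by (intro has_integral_bound [of \<delta> "\<lambda>z. g z - ramp b a z"])
        (auto simp: abs_minus_commute less_imp_le)
    then show ?thesis by simp
  qed
  note I = this
  define R where "R n = 2 * \<delta> + (\<Sum>i\<le>m. \<bar>c i\<bar> * sqrt (moment_const (Suc i) * mean_err n))
       + (1 + (\<Sum>i\<le>m. \<bar>c i\<bar> * (real (Suc i) * 2 ^ i))) * mean_err n" for n
  have "R \<longlonglongrightarrow> 2 * \<delta> + (\<Sum>i\<le>m. \<bar>c i\<bar> * sqrt (moment_const (Suc i) * 0))
       + (1 + (\<Sum>i\<le>m. \<bar>c i\<bar> * (real (Suc i) * 2 ^ i))) * 0"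
    unfolding R_def by (intro tendsto_intros mean_err_lim)
  then have "R \<longlonglongrightarrow> 2 * \<delta>" by simp
  then have "\<forall>\<^sub>F n in sequentially. R n < e"
    by (rule order_tendstoD) (use e in \<open>simp add: \<delta>_def\<close>)
  then show "\<forall>\<^sub>F n in sequentially. dist (mean_ramp_error b a n) 0 < e"
    using eventually_N_ge
  proof eventually_elim
    case (elim n)
    then interpret stationary_solitaire "p n" "q n" n "\<pi> n" by (intro solitaire) simp
    have "mean_ramp_error b a n \<le> R n"
      unfolding mean_ramp_error_def ramp_error_def [abs_def] I_def [symmetric] R_def mean_err_def
    proof (rule polynomial_approx)
      show "\<bar>ramp b a z - (\<Sum>i\<le>m. c i * z ^ i)\<bar> \<le> \<delta>" if "0 \<le> z" "z \<le> 2" for z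
        using g(2) [of z] that by (simp add: gc)
      show "\<bar>ramp b a z\<bar> \<le> 1" if "2 \<le> z" for z
      proof -
        have "1 / max z b \<le> 1" using that by simp
        then show ?thesis using ramp_le [OF ba, of z] ramp_nonneg [OF ba, of z] by simp
      qed
    qed (use elim \<delta> I in auto)
    moreover have "0 \<le> mean_ramp_error b a n"
      unfolding mean_ramp_error_def
      using expc_mono [of "\<lambda>_. 0" "ramp_error b a"] by (simp add: ramp_error_def)
    ultimately show ?case using elim by simp
  qed
qed

end

theorem theorem3:
  fixes p q :: "nat \<Rightarrow> real" and \<pi> :: "nat \<Rightarrow> nat list \<Rightarrow> real"
  assumes "\<forall>n\<ge>1. 0 < p n \<and> p n \<le> 1 \<and> 0 < q n \<and> q n \<le> 1"
    and "\<forall>n\<ge>1. stationary (p n) (q n) n (\<pi> n)"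
    and "(\<lambda>n. p n * q n) \<longlonglongrightarrow> 0"
    and "filterlim (\<lambda>n. p n * (q n)^2 * real n / ln (real n)) at_top sequentially"
  shows "\<forall>x>0. \<forall>\<epsilon>>0.
    (\<lambda>n. \<Sum>lam\<in>{lam\<in>partitions n. \<bar>rho (1 / (p n * q n)) n lam x - exp (- x)\<bar> < \<epsilon>}. \<pi> n lam)
      \<longlonglongrightarrow> 1"
proof (intro allI impI)
  fix x \<epsilon> :: real assume x: "0 < x" and \<epsilon>: "0 < \<epsilon>"
  interpret solitaire_sequence p q \<pi> by unfold_locales (fact assms)+
  define b\<^sub>1 where "b\<^sub>1 = exp (- x) + \<epsilon> / 2"
  \<comment> \<open>The second argument of the maximum keeps \<open>b\<^sub>2\<close> positive when
    \<open>\<epsilon>\<close> is large; \<open>a\<close> is then placed between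
    \<open>b\<^sub>2\<close> and \<open>exp (- x)\<close>.\<close>
  define b\<^sub>2 where "b\<^sub>2 = max (exp (- x) - \<epsilon> / 2) (exp (- x) / 2)"
  define a where "a = (b\<^sub>2 + exp (- x)) / 2"
  \<comment> \<open>The smaller of the two gaps between \<open>x\<close> and the integral bounds; it
    is positive because \<open>a < exp (- x) < b\<^sub>1\<close> and \<open>x > 0\<close>.\<close>
  define \<eta> where "\<eta> = min (x - max 0 (- ln b\<^sub>1)) (- ln a - x)"
  have b\<^sub>1: "0 < b\<^sub>1" "exp (- x) < b\<^sub>1" "b\<^sub>1 < exp (- x) + \<epsilon>"
    using \<epsilon> by (auto simp: b\<^sub>1_def add_pos_pos)
  have b\<^sub>2: "0 < b\<^sub>2" "b\<^sub>2 < exp (- x)" "exp (- x) - \<epsilon> < b\<^sub>2"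
    using \<epsilon> by (auto simp: b\<^sub>2_def max_def)
  have a: "b\<^sub>2 < a" "a < exp (- x)" "0 < a" using b\<^sub>2 by (auto simp: a_def)
  have "exp (- x) < 1" using x by simp
  then have a1: "a \<le> 1" using a by linarith
  have "- x < ln b\<^sub>1" using b\<^sub>1 ln_less_cancel_iff [of "exp (- x)" b\<^sub>1] by simp
  moreover have "ln a < - x" using a ln_less_cancel_iff [of a "exp (- x)"] by simp
  ultimately have \<eta>: "0 < \<eta>" "max 0 (- ln b\<^sub>1) + \<eta> \<le> x" "x + \<eta> \<le> - ln a"
    using x by (auto simp: \<eta>_def)
  let ?P = "\<lambda>n. \<Sum>lam\<in>{lam\<in>partitions n. \<bar>rho (1 / (p n * q n)) n lam x - exp (- x)\<bar> < \<epsilon>}. \<pi> n lam"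
  let ?E = "\<lambda>n. (mean_ramp_error b\<^sub>1 (exp (- x) + \<epsilon>) n + mean_ramp_error b\<^sub>2 a n) / \<eta>"
  have "?E \<longlonglongrightarrow> (0 + 0) / \<eta>"
    using \<eta> b\<^sub>1 b\<^sub>2 a by (intro tendsto_intros mean_ramp_error_lim) auto
  then have "(\<lambda>n. 1 - ?E n) \<longlonglongrightarrow> 1 - (0 + 0) / \<eta>"
    by (intro tendsto_diff tendsto_const)
  then have low: "(\<lambda>n. 1 - ?E n) \<longlonglongrightarrow> 1" by simp
  have "\<forall>\<^sub>F n in sequentially. 1 - ?E n \<le> ?P n"
    using eventually_ge_at_top [of 1]
  proof eventually_elim
    case (elim n)
    then interpret stationary_solitaire "p n" "q n" n "\<pi> n" by (rule solitaire)
    show ?case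
      using shape_deviation [OF x \<epsilon> \<eta>(1) b\<^sub>1(1,3) \<eta>(2) b\<^sub>2(1,3) a(1) a1 \<eta>(3)]
      by (simp add: mean_ramp_error_def)
  qed
  moreover have "\<forall>\<^sub>F n in sequentially. ?P n \<le> 1"
    using eventually_ge_at_top [of 1]
  proof eventually_elim
    case (elim n)
    then interpret stationary_solitaire "p n" "q n" n "\<pi> n" by (rule solitaire)
    have "?P n \<le> (\<Sum>lam\<in>partitions n. \<pi> n lam)"
      by (intro sum_mono2) (auto simp: \<pi>_nonneg)
    also have "\<dots> = 1" by (rule \<pi>_total)
    finally show ?case .
  qed
  ultimately show "?P \<longlonglongrightarrow> 1"
    by (rule tendsto_sandwich [OF _ _ low tendsto_const])
qed

end
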